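(* Let $X$ be a Hopf surface. There exist filtrable rank-2 holomorphic vector bundles $E$ on $X$ such that the projective bundle $\mathbb{P}(E)$ admits a non-trivial (i.e. non-zero) holomorphic Poisson structure.
   Context: Here a Hopf surface means a non-Kähler principal elliptic surface over $\mathbb{P}^1$: $X=\Theta^*/(\tau)$, where $\Theta$ is a holomorphic line bundle of non-zero degree on $\mathbb{P}^1$, $\Theta^*$ is the complement of the zero section in its total space, and $\tau\in\mathbb{C}$ with $|\tau|>1$ acts by fibrewise multiplication. A rank-2 bundle is filtrable if it admits a rank-1 subsheaf. A holomorphic Poisson structure on a complex manifold $Y$ is a section $\sigma\in H^0(Y,\wedge^2\mathcal{T}_Y)$ whose Schouten bracket $[\sigma,\sigma]$ vanishes. *)

theory Defs
  imports "HOL-Analysis.Analysis" "HOL-Complex_Analysis.Complex_Analysis"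
begin

no_notation fps_nth (infixl \<open>$\<close> 75)

section \<open>Holomorphic functions of several variables\<close>

definition holo_on :: "(complex^'n \<Rightarrow> complex) \<Rightarrow> (complex^'n) set \<Rightarrow> bool" where
  "holo_on f S \<longleftrightarrow> (\<forall>z\<in>S. \<exists>D. (f has_derivative D) (at z) \<and> (\<forall>c v. D (c *s v) = c * D v))"

definition pderiv_at :: "'n \<Rightarrow> (complex^'n \<Rightarrow> complex) \<Rightarrow> complex^'n \<Rightarrow> complex" where
  "pderiv_at l f z = deriv (\<lambda>t. f (z + t *s axis l 1)) 0"

definition jacobian :: "(complex^'n \<Rightarrow> complex^'m) \<Rightarrow> complex^'n \<Rightarrow> complex^'n^'m" where
  "jacobian F z = (\<chi> i j. pderiv_at j (\<lambda>w. F w $ i) z)"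


section \<open>Complex manifolds given by atlases\<close>

text \<open>A complex structure is presented by an atlas, that is, a set of charts \<open>(U, \<phi>)\<close>, where \<open>\<phi>\<close>
  is a bijection of \<open>U\<close> onto an open set of coordinate space. The topology is the one that the
  charts induce. Values of \<open>\<phi>\<close> outside \<open>U\<close> are irrelevant. Compatibility of charts is not part of
  the type: the atlases that occur below are explicit (the projective line, total spaces, quotients,
  projectivizations) and have holomorphic transition maps by construction.\<close>

type_synonym ('a, 'n) chart = "'a set \<times> ('a \<Rightarrow> (complex, 'n) vec)"
type_synonym ('a, 'n) atlas = "('a, 'n) chart set"

definition points :: "('a, 'n::finite) atlas \<Rightarrow> 'a set" where
  "points A = \<Union> (fst ` A)"

definition open_in :: "('a, 'n::finite) atlas \<Rightarrow> 'a set \<Rightarrow> bool" where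
  "open_in A S \<longleftrightarrow> S \<subseteq> points A \<and> (\<forall>(U, \<phi>)\<in>A. open (\<phi> ` (U \<inter> S)))"

definition holo_fun :: "('a, 'n::finite) atlas \<Rightarrow> ('a \<Rightarrow> complex) \<Rightarrow> 'a set \<Rightarrow> bool" where
  "holo_fun A f S \<longleftrightarrow> (\<forall>(U, \<phi>)\<in>A. holo_on (f \<circ> inv_into U \<phi>) (\<phi> ` (U \<inter> S)))"

definition open_submanifold :: "('a, 'n::finite) atlas \<Rightarrow> 'a set \<Rightarrow> ('a, 'n) atlas" where
  "open_submanifold A S = {(U \<inter> S, \<phi>) | U \<phi>. (U, \<phi>) \<in> A}"

text \<open>For a quotient map \<open>q\<close> by a free and properly discontinuous action: the charts of the quotient
  are the charts upstairs, restricted to open sets on which \<open>q\<close> is injective and then pushed down.\<close>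

definition quotient_atlas :: "('a, 'n::finite) atlas \<Rightarrow> ('a \<Rightarrow> 'b) \<Rightarrow> ('b, 'n) atlas" where
  "quotient_atlas A q =
     {(q ` W, \<phi> \<circ> inv_into W q) | U \<phi> W. (U, \<phi>) \<in> A \<and> W \<subseteq> U \<and> open_in A W \<and> inj_on q W}"


section \<open>The projective line\<close>

definition cline :: "complex^2 \<Rightarrow> (complex^2) set" where
  "cline v = range (\<lambda>c. c *s v)"

definition clines :: "(complex^2) set set" where
  "clines = cline ` {v. v \<noteq> 0}"

text \<open>The affine coordinate \<open>v\<^sub>m / v\<^sub>k\<close> of a line on which \<open>v\<^sub>k\<close> is not identically zero, where
  \<open>m\<close> is the index different from \<open>k\<close>.\<close>

definition other :: "2 \<Rightarrow> 2" where
  "other k = (if k = 1 then 2 else 1)"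

definition affine_dom :: "2 \<Rightarrow> (complex^2) set set" where
  "affine_dom k = {L \<in> clines. \<exists>v\<in>L. v $ k \<noteq> 0}"

definition affine_coord :: "2 \<Rightarrow> (complex^2) set \<Rightarrow> complex" where
  "affine_coord k L = (THE z. \<exists>v\<in>L. v $ k = 1 \<and> z = v $ other k)"

definition CP1 :: "((complex^2) set, 1) atlas" where
  "CP1 = {(affine_dom k, \<lambda>L. vec (affine_coord k L)) | k. True}"

lemma affine_coord_cline:
  assumes "v $ k \<noteq> 0"
  shows "affine_coord k (cline v) = v $ other k / v $ k"
  unfolding affine_coord_def
proof (rule the_equality)
  show "\<exists>w\<in>cline v. w $ k = 1 \<and> v $ other k / v $ k = w $ other k"
    using assms by (auto simp: cline_def intro!: exI[of _ "inverse (v $ k)"] simp: field_simps)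
next
  fix z assume "\<exists>w\<in>cline v. w $ k = 1 \<and> z = w $ other k"
  then obtain c where "c * v $ k = 1" "z = c * v $ other k"
    by (auto simp: cline_def)
  then show "z = v $ other k / v $ k"
    using assms by (simp add: field_simps)
qed

lemma points_CP1: "points CP1 = clines"
proof -
  have "\<exists>k. L \<in> affine_dom k" if L: "L \<in> clines" for L
  proof -
    obtain v where v: "v \<noteq> 0" "L = cline v" using L by (auto simp: clines_def)
    then obtain k where "v $ k \<noteq> 0" by (metis vec_eq_iff zero_index)
    moreover have "v \<in> L" using v by (auto simp: cline_def intro!: range_eqI[of _ _ 1])
    ultimately show ?thesis using L by (auto simp: affine_dom_def)
  qed
  moreover have "points CP1 = (\<Union>k. affine_dom k)"
    by (auto simp: points_def CP1_def)
  ultimately show ?thesis by (fastforce simp: affine_dom_def)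
qed


section \<open>Holomorphic vector bundles\<close>

text \<open>A bundle has a total space, a projection, and local trivializations \<open>(V, \<psi>)\<close>: over \<open>V\<close>, the map
  \<open>e \<mapsto> (\<pi> e, \<psi> e)\<close> identifies the total space with \<open>V \<times> \<complex>\<^sup>r\<close>. As the transition functions are linear,
  each fibre carries a well-defined vector space structure.\<close>

record ('e, 'a, 'r) vbundle =
  tot :: "'e set"
  prj :: "'e \<Rightarrow> 'a"
  trivs :: "('a set \<times> ('e \<Rightarrow> (complex, 'r) vec)) set"

definition fibre :: "('e, 'a, 'r::finite) vbundle \<Rightarrow> 'a \<Rightarrow> 'e set" where
  "fibre E x = {e \<in> tot E. prj E e = x}"

definition holomorphic_vector_bundle ::
    "('a, 'n::finite) atlas \<Rightarrow> ('e, 'a, 'r::finite) vbundle \<Rightarrow> bool" where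
  "holomorphic_vector_bundle A E \<longleftrightarrow>
     prj E ` tot E \<subseteq> points A \<and>
     \<Union> (fst ` trivs E) = points A \<and>
     (\<forall>(V, \<psi>)\<in>trivs E. open_in A V \<and> (\<forall>x\<in>V. bij_betw \<psi> (fibre E x) UNIV)) \<and>
     (\<forall>(V, \<psi>)\<in>trivs E. \<forall>(V', \<psi>')\<in>trivs E. \<exists>g :: 'a \<Rightarrow> complex^'r^'r.
        (\<forall>i j. holo_fun A (\<lambda>x. g x $ i $ j) (V \<inter> V')) \<and>
        (\<forall>x \<in> V \<inter> V'. \<forall>e \<in> fibre E x. \<psi>' e = g x *v \<psi> e))"

definition total_atlas ::
    "('a, 'n::finite) atlas \<Rightarrow> ('e, 'a, 'r::finite) vbundle \<Rightarrow> ('e, 'n + 'r) atlas" where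
  "total_atlas A E =
     {({e \<in> tot E. prj E e \<in> U \<inter> V},
       \<lambda>e. \<chi> i. case i of Inl k \<Rightarrow> \<phi> (prj E e) $ k | Inr k \<Rightarrow> \<psi> e $ k)
      | U \<phi> V \<psi>. (U, \<phi>) \<in> A \<and> (V, \<psi>) \<in> trivs E}"

definition fibre_scale :: "('e, 'a, 'r::finite) vbundle \<Rightarrow> complex \<Rightarrow> 'e \<Rightarrow> 'e" where
  "fibre_scale E c e =
     (THE e'. e' \<in> fibre E (prj E e) \<and> (\<forall>(V, \<psi>)\<in>trivs E. prj E e \<in> V \<longrightarrow> \<psi> e' = c *s \<psi> e))"

definition zero_section_compl :: "('e, 'a, 'r::finite) vbundle \<Rightarrow> 'e set" where
  "zero_section_compl E = {e \<in> tot E. \<forall>(V, \<psi>)\<in>trivs E. prj E e \<in> V \<longrightarrow> \<psi> e \<noteq> 0}"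


section \<open>Degree of a line bundle on a compact Riemann surface\<close>

text \<open>The degree is the number of zeros minus the number of poles, with multiplicity, of a
  meromorphic section that is not identically zero near any point. The value of \<open>s\<close> at a pole is an
  arbitrary element of the fibre; neither \<open>meromorphic_on\<close> nor \<open>zorder\<close> looks at it.\<close>

definition has_degree :: "('a, 1) atlas \<Rightarrow> ('e, 'a, 1) vbundle \<Rightarrow> int \<Rightarrow> bool" where
  "has_degree A \<Theta> d \<longleftrightarrow> (\<exists>(s :: 'a \<Rightarrow> 'e) (ord :: 'a \<Rightarrow> int).
     (\<forall>x\<in>points A. s x \<in> fibre \<Theta> x) \<and>
     (\<forall>(U, \<phi>)\<in>A. \<forall>(V, \<psi>)\<in>trivs \<Theta>. \<forall>x \<in> U \<inter> V.
        let f = (\<lambda>z :: complex. \<psi> (s (inv_into U \<phi> (vec z))) $ 1); z\<^sub>0 = \<phi> x $ 1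
        in f meromorphic_on {z\<^sub>0} \<and> (\<exists>\<^sub>F z in at z\<^sub>0. f z \<noteq> 0) \<and> ord x = zorder f z\<^sub>0) \<and>
     finite {x \<in> points A. ord x \<noteq> 0} \<and>
     d = (\<Sum>x | x \<in> points A \<and> ord x \<noteq> 0. ord x))"


section \<open>Hopf surfaces\<close>

definition orbit :: "('e, 'a, 'r::finite) vbundle \<Rightarrow> complex \<Rightarrow> 'e \<Rightarrow> 'e set" where
  "orbit \<Theta> \<tau> e = {fibre_scale \<Theta> (\<tau> powi k) e | k :: int. True}"

definition hopf_surface :: "('e set, 1 + 1) atlas \<Rightarrow> bool" where
  "hopf_surface X \<longleftrightarrow> (\<exists>(\<Theta> :: ('e, (complex^2) set, 1) vbundle) d \<tau>.
     holomorphic_vector_bundle CP1 \<Theta> \<and> has_degree CP1 \<Theta> d \<and> d \<noteq> 0 \<and> cmod \<tau> > 1 \<and>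
     X = quotient_atlas (open_submanifold (total_atlas CP1 \<Theta>) (zero_section_compl \<Theta>)) (orbit \<Theta> \<tau>))"


section \<open>Subsheaves and filtrability\<close>

text \<open>Sections over \<open>S\<close> are made \<open>undefined\<close> outside \<open>S\<close>, so that equality of sections is equality of
  functions and restriction of sections is \<open>restrict\<close>.\<close>

definition sections ::
    "('a, 'n::finite) atlas \<Rightarrow> ('e, 'a, 'r::finite) vbundle \<Rightarrow> 'a set \<Rightarrow> ('a \<Rightarrow> 'e) set" where
  "sections A E S = {s \<in> extensional S. (\<forall>x\<in>S. s x \<in> fibre E x) \<and>
     (\<forall>(V, \<psi>)\<in>trivs E. \<forall>i. holo_fun A (\<lambda>x. \<psi> (s x) $ i) (V \<inter> S))}"

text \<open>\<open>lin_comb E S u n f s\<close> says that \<open>u = \<Sum>i<n. f i \<cdot> s i\<close> on \<open>S\<close>.\<close>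

definition lin_comb :: "('e, 'a, 'r::finite) vbundle \<Rightarrow> 'a set \<Rightarrow> ('a \<Rightarrow> 'e) \<Rightarrow>
    nat \<Rightarrow> (nat \<Rightarrow> 'a \<Rightarrow> complex) \<Rightarrow> (nat \<Rightarrow> 'a \<Rightarrow> 'e) \<Rightarrow> bool" where
  "lin_comb E S u n f s \<longleftrightarrow>
     (\<forall>(V, \<psi>)\<in>trivs E. \<forall>x \<in> V \<inter> S. \<psi> (u x) = (\<Sum>i<n. f i x *s \<psi> (s i x)))"

text \<open>A sheaf of \<open>\<O>\<close>-submodules of the sheaf of sections of \<open>E\<close>. Closure under empty combinations
  gives the zero section.\<close>

definition subsheaf :: "('a, 'n::finite) atlas \<Rightarrow> ('e, 'a, 'r::finite) vbundle \<Rightarrow>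
    ('a set \<Rightarrow> ('a \<Rightarrow> 'e) set) \<Rightarrow> bool" where
  "subsheaf A E F \<longleftrightarrow>
     (\<forall>S. open_in A S \<longrightarrow> F S \<subseteq> sections A E S) \<and>
     (\<forall>S n f s u. open_in A S \<and> (\<forall>i<n. holo_fun A (f i) S \<and> s i \<in> F S) \<and>
        u \<in> sections A E S \<and> lin_comb E S u n f s \<longrightarrow> u \<in> F S) \<and>
     (\<forall>S T s. open_in A S \<and> open_in A T \<and> T \<subseteq> S \<and> s \<in> F S \<longrightarrow> restrict s T \<in> F T) \<and>
     (\<forall>C u. (\<forall>T\<in>C. open_in A T \<and> restrict u T \<in> F T) \<and> u \<in> sections A E (\<Union>C) \<longrightarrow> u \<in> F (\<Union>C))"

definition finite_type :: "('a, 'n::finite) atlas \<Rightarrow> ('e, 'a, 'r::finite) vbundle \<Rightarrow>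
    ('a set \<Rightarrow> ('a \<Rightarrow> 'e) set) \<Rightarrow> bool" where
  "finite_type A E F \<longleftrightarrow> (\<forall>x\<in>points A. \<exists>S n s.
     open_in A S \<and> x \<in> S \<and> (\<forall>i<n. s i \<in> F S) \<and>
     (\<forall>T t y. open_in A T \<and> T \<subseteq> S \<and> t \<in> F T \<and> y \<in> T \<longrightarrow>
        (\<exists>T' f. open_in A T' \<and> y \<in> T' \<and> T' \<subseteq> T \<and>
           (\<forall>i<n. holo_fun A (f i) T') \<and> lin_comb E T' t n f s)))"

text \<open>Linear independence over the local ring \<open>\<O>\<^sub>x\<close> of the germs at \<open>x\<close> of \<open>s 0, \<dots>, s (n - 1)\<close>.\<close>

definition germs_independent :: "('a, 'n::finite) atlas \<Rightarrow> ('e, 'a, 'r::finite) vbundle \<Rightarrow>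
    'a \<Rightarrow> 'a set \<Rightarrow> nat \<Rightarrow> (nat \<Rightarrow> 'a \<Rightarrow> 'e) \<Rightarrow> bool" where
  "germs_independent A E x S n s \<longleftrightarrow>
     (\<forall>T f. open_in A T \<and> x \<in> T \<and> T \<subseteq> S \<and> (\<forall>i<n. holo_fun A (f i) T) \<and>
        (\<forall>(V, \<psi>)\<in>trivs E. \<forall>y \<in> V \<inter> T. (\<Sum>i<n. f i y *s \<psi> (s i y)) = 0) \<longrightarrow>
        (\<exists>T'. open_in A T' \<and> x \<in> T' \<and> T' \<subseteq> T \<and> (\<forall>i<n. \<forall>y\<in>T'. f i y = 0)))"

definition has_independent_germs :: "('a, 'n::finite) atlas \<Rightarrow> ('e, 'a, 'r::finite) vbundle \<Rightarrow>
    ('a set \<Rightarrow> ('a \<Rightarrow> 'e) set) \<Rightarrow> 'a \<Rightarrow> nat \<Rightarrow> bool" where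
  "has_independent_germs A E F x n \<longleftrightarrow>
     (\<exists>S s. open_in A S \<and> x \<in> S \<and> (\<forall>i<n. s i \<in> F S) \<and> germs_independent A E x S n s)"

text \<open>The rank of a stalk is the maximal number of linearly independent elements; on a connected
  manifold it does not depend on the point when the subsheaf is coherent.\<close>

definition sheaf_rank :: "('a, 'n::finite) atlas \<Rightarrow> ('e, 'a, 'r::finite) vbundle \<Rightarrow>
    ('a set \<Rightarrow> ('a \<Rightarrow> 'e) set) \<Rightarrow> nat \<Rightarrow> bool" where
  "sheaf_rank A E F n \<longleftrightarrow>
     (\<forall>x\<in>points A. has_independent_germs A E F x n \<and> \<not> has_independent_germs A E F x (Suc n))"

text \<open>By Oka's theorem a subsheaf of a locally free sheaf is coherent as soon as it is of finite type.\<close>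

definition filtrable :: "('a, 'n::finite) atlas \<Rightarrow> ('e, 'a, 2) vbundle \<Rightarrow> bool" where
  "filtrable A E \<longleftrightarrow> (\<exists>F. subsheaf A E F \<and> finite_type A E F \<and> sheaf_rank A E F 1)"


section \<open>Projectivization of a rank-2 bundle\<close>

definition proj_points :: "('e, 'a, 2) vbundle \<Rightarrow> 'e set set" where
  "proj_points E =
     {{e \<in> fibre E x. \<psi> e \<in> L} | x L V \<psi>. (V, \<psi>) \<in> trivs E \<and> x \<in> V \<and> L \<in> clines}"

definition proj_base :: "('e, 'a, 2) vbundle \<Rightarrow> 'e set \<Rightarrow> 'a" where
  "proj_base E \<ll> = (THE x. \<ll> \<subseteq> fibre E x)"

definition proj_bundle :: "('a, 'n::finite) atlas \<Rightarrow> ('e, 'a, 2) vbundle \<Rightarrow> ('e set, 'n + 1) atlas" where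
  "proj_bundle A E =
     {({\<ll> \<in> proj_points E. proj_base E \<ll> \<in> U \<inter> V \<and> \<psi> ` \<ll> \<in> affine_dom k},
       \<lambda>\<ll>. \<chi> i. case i of Inl j \<Rightarrow> \<phi> (proj_base E \<ll>) $ j | Inr _ \<Rightarrow> affine_coord k (\<psi> ` \<ll>))
      | U \<phi> V \<psi> k. (U, \<phi>) \<in> A \<and> (V, \<psi>) \<in> trivs E}"


section \<open>Holomorphic Poisson structures\<close>

text \<open>A bivector field is given by its components in the charts: for a chart \<open>c = (U, \<phi>)\<close>, \<open>\<sigma> c\<close> is the
  skew-symmetric matrix-valued function on \<open>\<phi> ` U\<close> for which the bivector field is
  \<open>(1/2) \<Sum>i j. \<sigma> c z $ i $ j \<cdot> \<partial>\<^sub>i \<and> \<partial>\<^sub>j\<close>; components in different charts are related by the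
  transformation law of contravariant 2-tensors.\<close>

definition holomorphic_bivector :: "('a, 'n::finite) atlas \<Rightarrow>
    (('a, 'n) chart \<Rightarrow> complex^'n \<Rightarrow> complex^'n^'n) \<Rightarrow> bool" where
  "holomorphic_bivector A \<sigma> \<longleftrightarrow>
     (\<forall>(U, \<phi>)\<in>A.
        (\<forall>i j. holo_on (\<lambda>z. \<sigma> (U, \<phi>) z $ i $ j) (\<phi> ` U)) \<and>
        (\<forall>z \<in> \<phi> ` U. transpose (\<sigma> (U, \<phi>) z) = - \<sigma> (U, \<phi>) z)) \<and>
     (\<forall>(U, \<phi>)\<in>A. \<forall>(V, \<psi>)\<in>A. \<forall>p \<in> U \<inter> V.
        let J = jacobian (\<psi> \<circ> inv_into U \<phi>) (\<phi> p)
        in \<sigma> (V, \<psi>) (\<psi> p) = J ** \<sigma> (U, \<phi>) (\<phi> p) ** transpose J)"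

text \<open>The components of the Schouten bracket \<open>[P, Q]\<close> of two bivector fields in coordinates (up to a
  global sign, which depends on conventions).\<close>

definition schouten :: "(complex^'n::finite \<Rightarrow> complex^'n^'n) \<Rightarrow> (complex^'n \<Rightarrow> complex^'n^'n) \<Rightarrow>
    complex^'n \<Rightarrow> 'n \<Rightarrow> 'n \<Rightarrow> 'n \<Rightarrow> complex" where
  "schouten P Q z i j k = (\<Sum>l\<in>UNIV.
       P z $ l $ i * pderiv_at l (\<lambda>w. Q w $ j $ k) z + Q z $ l $ i * pderiv_at l (\<lambda>w. P w $ j $ k) z
     + P z $ l $ j * pderiv_at l (\<lambda>w. Q w $ k $ i) z + Q z $ l $ j * pderiv_at l (\<lambda>w. P w $ k $ i) z
     + P z $ l $ k * pderiv_at l (\<lambda>w. Q w $ i $ j) z + Q z $ l $ k * pderiv_at l (\<lambda>w. P w $ i $ j) z)"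

definition poisson_structure :: "('a, 'n::finite) atlas \<Rightarrow>
    (('a, 'n) chart \<Rightarrow> complex^'n \<Rightarrow> complex^'n^'n) \<Rightarrow> bool" where
  "poisson_structure A \<sigma> \<longleftrightarrow> holomorphic_bivector A \<sigma> \<and>
     (\<forall>(U, \<phi>)\<in>A. \<forall>z \<in> \<phi> ` U. \<forall>i j k. schouten (\<sigma> (U, \<phi>)) (\<sigma> (U, \<phi>)) z i j k = 0)"

definition nonzero_bivector :: "('a, 'n::finite) atlas \<Rightarrow>
    (('a, 'n) chart \<Rightarrow> complex^'n \<Rightarrow> complex^'n^'n) \<Rightarrow> bool" where
  "nonzero_bivector A \<sigma> \<longleftrightarrow> (\<exists>(U, \<phi>)\<in>A. \<exists>z \<in> \<phi> ` U. \<sigma> (U, \<phi>) z \<noteq> 0)"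

end

theory Submission
  imports Defs
begin

text \<open>The trivial bundle \<open>E = \<O> \<oplus> \<O>\<close> already works. It is filtered by its first summand, and
  \<open>\<P>(E) = X \<times> \<P>\<^sup>1\<close>. The fibrewise \<open>\<complex>\<^sup>*\<close>-action on \<open>\<Theta>\<^sup>*\<close> commutes with multiplication by \<open>\<tau>\<close>, so
  its generator descends to a nowhere vanishing vector field \<open>v\<close> on \<open>X\<close>. If \<open>w\<close> is a non-zero vector
  field on \<open>\<P>\<^sup>1\<close>, then \<open>v\<close> and \<open>w\<close> commute on the product, whence \<open>[v \<and> w, v \<and> w] = 0\<close>.\<close>

section \<open>Holomorphic functions and partial derivatives\<close>

text \<open>On the projectivization of a general bundle there is no canonical lift of a field from
  the base. The single global trivialization of the trivial bundle turns every chart of the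
  projectivization into a base chart times an affine chart of the line. The Jacobians are then block
  diagonal, and the two factors of the wedge product can be treated separately. Two difficulties
  shape the rest. A chart of the projectivization does not record which base chart it came from,
  whereas the components of a bivector are indexed by charts; a choice is made, and it has to be
  shown harmless. A chart of the quotient lives on the image of an open set on which the orbit map
  is injective, so a point in the overlap of two charts has two lifts, related by some power of
  \<tau>. Derivatives of transition maps are therefore computed by scaling both lifts
  simultaneously. That such charts exist at all, without which no bivector could be non-zero, comes
  from the annuli on which the fibre coordinate has modulus strictly between 1 and |\<tau>|.\<close>

lemma holo_on_const: "holo_on (\<lambda>z. c) S"
  unfolding holo_on_def by (auto intro!: exI[of _ "\<lambda>v. 0"])

lemma holo_on_nth: "holo_on (\<lambda>z. z $ i) S"
  unfolding holo_on_def
  by (auto intro!: exI[of _ "\<lambda>v. v $ i"] bounded_linear_imp_has_derivative bounded_linear_vec_nth)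

lemma holo_on_mult:
  assumes "holo_on f S" "holo_on g S"
  shows "holo_on (\<lambda>z. f z * g z) S"
  unfolding holo_on_def
proof
  fix z assume z: "z \<in> S"
  obtain D E where D: "(f has_derivative D) (at z)" "\<And>c v. D (c *s v) = c * D v"
    and E: "(g has_derivative E) (at z)" "\<And>c v. E (c *s v) = c * E v"
    using assms z unfolding holo_on_def by meson
  show "\<exists>D. ((\<lambda>z. f z * g z) has_derivative D) (at z) \<and> (\<forall>c v. D (c *s v) = c * D v)"
    using has_derivative_mult[OF D(1) E(1)] D(2) E(2)
    by (intro exI[of _ "\<lambda>h. f z * E h + D h * g z"]) (auto simp: algebra_simps)
qed

lemma holo_on_minus:
  assumes "holo_on f S"
  shows "holo_on (\<lambda>z. - f z) S"
  using holo_on_mult[OF holo_on_const[of "-1"] assms] by simp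

lemma holo_on_subset: "holo_on f S \<Longrightarrow> T \<subseteq> S \<Longrightarrow> holo_on f T"
  unfolding holo_on_def by blast

text \<open>\<open>holo_on\<close> speaks of derivatives of a total function at each point, so
  agreement on a set carries holomorphy over only if the set is open. This is why openness of chart
  images recurs below.\<close>

lemma holo_on_cong_open:
  assumes "open S" "\<And>z. z \<in> S \<Longrightarrow> f z = g z" "holo_on f S"
  shows "holo_on g S"
  using assms has_derivative_transform_within_open[of f _ _ UNIV S g] unfolding holo_on_def by blast

lemma holo_on_imp_continuous_on:
  assumes "holo_on f S"
  shows "continuous_on S f"
  using assms has_derivative_continuous unfolding holo_on_def
  by (metis continuous_at_imp_continuous_on)

definition proj_left :: "complex^('n::finite + 'm::finite) \<Rightarrow> complex^'n" where
  "proj_left z = (\<chi> i. z $ Inl i)"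

lemma proj_left_nth [simp]: "proj_left z $ i = z $ Inl i"
  by (simp add: proj_left_def)

lemma bounded_linear_proj_left: "bounded_linear (proj_left :: complex^('n::finite + 'm::finite) \<Rightarrow> _)"
proof -
  have "linear (proj_left :: complex^('n + 'm) \<Rightarrow> _)"
    by (rule linearI) (auto simp: vec_eq_iff)
  then show ?thesis by (simp add: linear_conv_bounded_linear)
qed

lemma holo_on_proj_left:
  assumes "holo_on f S" "proj_left ` T \<subseteq> S"
  shows "holo_on (\<lambda>z. f (proj_left z)) T"
  unfolding holo_on_def
proof
  fix z assume z: "z \<in> T"
  then obtain D where D: "(f has_derivative D) (at (proj_left z))" "\<And>c v. D (c *s v) = c * D v"
    using assms unfolding holo_on_def by blast
  have "((\<lambda>z. f (proj_left z)) has_derivative (\<lambda>h. D (proj_left h))) (at z)"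
    using D(1) bounded_linear_imp_has_derivative[OF bounded_linear_proj_left]
    by (rule has_derivative_compose[rotated])
  moreover have "proj_left (c *s v) = c *s proj_left v" for c and v :: "complex^('a + 'b)"
    by (simp add: vec_eq_iff)
  ultimately show "\<exists>D. ((\<lambda>z. f (proj_left z)) has_derivative D) (at z) \<and> (\<forall>c v. D (c *s v) = c * D v)"
    using D(2) by auto
qed

section \<open>Partial derivatives along complex lines\<close>

lemma tendsto_line: "((\<lambda>t. z + t *s w) \<longlongrightarrow> z) (nhds (0::complex))"
  for z w :: "complex^'n::finite"
proof (rule vec_tendstoI)
  fix i
  have "((\<lambda>t. z $ i + t * w $ i) \<longlongrightarrow> z $ i + 0 * w $ i) (nhds (0::complex))"
    by (intro tendsto_intros filterlim_ident)
  then show "((\<lambda>t. (z + t *s w) $ i) \<longlongrightarrow> z $ i) (nhds (0::complex))"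
    by simp
qed

lemma eventually_line:
  fixes z w :: "complex^'n::finite"
  assumes "open S" "z \<in> S"
  shows "\<forall>\<^sub>F t in nhds 0. z + t *s w \<in> S"
  using topological_tendstoD[OF tendsto_line assms] .

text \<open>Transition maps have explicit formulas only near the point in question. A partial
  derivative sees only the germ along the coordinate line, so an eventual equality is
  enough.\<close>

lemma pderiv_at_eq:
  assumes "\<forall>\<^sub>F t in nhds 0. f (z + t *s axis l 1) = h t" "(h has_field_derivative D) (at 0)"
  shows "pderiv_at l f z = D"
  unfolding pderiv_at_def
  using deriv_cong_ev[OF assms(1) refl] DERIV_imp_deriv[OF assms(2)] by simp

lemma pderiv_at_cong:
  assumes "\<forall>\<^sub>F t in nhds 0. f (z + t *s axis l 1) = g (z' + t *s axis l' 1)"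
  shows "pderiv_at l f z = pderiv_at l' g z'"
  unfolding pderiv_at_def using deriv_cong_ev[OF assms refl] .

lemma pderiv_at_const [simp]: "pderiv_at l (\<lambda>w. c) z = 0"
  by (simp add: pderiv_at_def)

text \<open>\<open>has_derivative\<close> is real differentiability. Complex linearity of the
  derivative \<open>D\<close> makes the restriction to the line have derivative
  \<open>t \<mapsto> D w * t\<close>, which is a complex derivative.\<close>

lemma holo_on_line_differentiable:
  fixes f :: "complex^'n::finite \<Rightarrow> complex"
  assumes "holo_on f S" "z \<in> S"
  shows "(\<lambda>t. f (z + t *s w)) field_differentiable at 0"
proof -
  obtain D where D: "(f has_derivative D) (at z)" "\<And>c v. D (c *s v) = c * D v"
    using assms unfolding holo_on_def by blast
  have "linear (\<lambda>t::complex. t *s w)"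
    by (rule linearI) (auto simp: vec_eq_iff algebra_simps)
  then have "((\<lambda>t::complex. z + t *s w) has_derivative (\<lambda>t. t *s w)) (at 0)"
    by (auto intro!: derivative_eq_intros bounded_linear_imp_has_derivative
        simp: linear_conv_bounded_linear)
  then have "((\<lambda>t. f (z + t *s w)) has_derivative (\<lambda>t. D (t *s w))) (at 0)"
    by (rule has_derivative_compose) (simp add: D)
  moreover have "(\<lambda>t. D (t *s w)) = (*) (D w)"
    by (auto simp: D(2))
  ultimately show ?thesis
    unfolding field_differentiable_def has_field_derivative_def by auto
qed

lemma pderiv_at_minus:
  fixes f :: "complex^'n::finite \<Rightarrow> complex"
  assumes "holo_on f S" "z \<in> S"
  shows "pderiv_at l (\<lambda>w. - f w) z = - pderiv_at l f z"
  using holo_on_line_differentiable[OF assms]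
  unfolding pderiv_at_def by (intro DERIV_imp_deriv derivative_intros field_differentiable_derivI)


section \<open>The trivial bundle of rank 2\<close>

text \<open>The type of atlases does not enforce either condition, yet \<open>inv_into\<close>
  inverts a chart properly only if the chart is injective, and \<open>holo_on\<close> can be
  localized to a chart image only if that image is open.\<close>

definition proper_atlas :: "('a, 'n::finite) atlas \<Rightarrow> bool" where
  "proper_atlas A \<longleftrightarrow> (\<forall>(U, \<phi>)\<in>A. inj_on \<phi> U \<and> open (\<phi> ` U))"

definition trivial_bundle :: "('a, 'n::finite) atlas \<Rightarrow> ('a \<times> (complex^'r), 'a, 'r::finite) vbundle" where
  "trivial_bundle A = \<lparr>tot = points A \<times> UNIV, prj = fst, trivs = {(points A, snd)}\<rparr>"

lemma trivial_bundle_simps [simp]: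
  "tot (trivial_bundle A) = points A \<times> UNIV"
  "prj (trivial_bundle A) = fst"
  "trivs (trivial_bundle A) = {(points A, snd)}"
  by (simp_all add: trivial_bundle_def)

lemma fibre_trivial_bundle [simp]:
  "fibre (trivial_bundle A) x = (if x \<in> points A then {x} \<times> UNIV else {})"
  by (auto simp: fibre_def)

lemma chart_subset_points: "(U, \<phi>) \<in> A \<Longrightarrow> U \<subseteq> points A"
  unfolding points_def by force

lemma open_in_points:
  assumes "proper_atlas A"
  shows "open_in A (points A)"
proof -
  have "U \<inter> points A = U" if "(U, \<phi>) \<in> A" for U and \<phi> :: "'a \<Rightarrow> complex^'b"
    using chart_subset_points[OF that] by blast
  then show ?thesis
    using assms unfolding open_in_def proper_atlas_def by fastforce
qed

lemma open_in_subset_points: "open_in A S \<Longrightarrow> S \<subseteq> points A"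
  by (simp add: open_in_def)

lemma holo_fun_const: "holo_fun A (\<lambda>x. c) S"
  by (auto simp: holo_fun_def comp_def holo_on_const)

lemma holo_fun_minus: "holo_fun A f S \<Longrightarrow> holo_fun A (\<lambda>x. - f x) S"
  by (fastforce simp: holo_fun_def comp_def intro: holo_on_minus)

lemma holo_fun_subset:
  assumes "holo_fun A f S" "T \<subseteq> S"
  shows "holo_fun A f T"
  unfolding holo_fun_def
proof safe
  fix U \<phi> assume "(U, \<phi>) \<in> A"
  then have "holo_on (f \<circ> inv_into U \<phi>) (\<phi> ` (U \<inter> S))"
    using assms(1) by (auto simp: holo_fun_def)
  then show "holo_on (f \<circ> inv_into U \<phi>) (\<phi> ` (U \<inter> T))"
    by (rule holo_on_subset) (use assms(2) in blast)
qed

lemma holo_fun_cong: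
  assumes A: "proper_atlas A" and S: "open_in A S"
    and eq: "\<And>x. x \<in> S \<Longrightarrow> f x = g x" and f: "holo_fun A f S"
  shows "holo_fun A g S"
  unfolding holo_fun_def
proof safe
  fix U \<phi> assume c: "(U, \<phi>) \<in> A"
  have "inj_on \<phi> U" "open (\<phi> ` (U \<inter> S))"
    using A S c by (auto simp: proper_atlas_def open_in_def)
  moreover have "holo_on (f \<circ> inv_into U \<phi>) (\<phi> ` (U \<inter> S))"
    using f c by (auto simp: holo_fun_def)
  ultimately show "holo_on (g \<circ> inv_into U \<phi>) (\<phi> ` (U \<inter> S))"
    by (rule_tac holo_on_cong_open[of _ "f \<circ> inv_into U \<phi>"]) (auto simp: eq inv_into_f_f)
qed

lemma holomorphic_trivial_bundle:
  assumes "proper_atlas A"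
  shows "holomorphic_vector_bundle A (trivial_bundle A :: ('a \<times> (complex^'r), 'a, 'r::finite) vbundle)"
proof -
  have "bij_betw snd ({x} \<times> UNIV) (UNIV :: (complex^'r) set)" for x :: 'a
    by (auto simp: bij_betw_def inj_on_def image_iff)
  moreover have "\<exists>g :: 'a \<Rightarrow> complex^'r^'r. (\<forall>i j. holo_fun A (\<lambda>x. g x $ i $ j) (points A)) \<and>
     (\<forall>x \<in> points A. \<forall>e :: 'a \<times> (complex^'r). e \<in> {x} \<times> UNIV \<longrightarrow> snd e = g x *v snd e)"
    by (rule exI[of _ "\<lambda>x. mat 1"]) (auto simp: holo_fun_const matrix_vector_mul_lid)
  ultimately show ?thesis
    using open_in_points[OF assms] by (auto simp: holomorphic_vector_bundle_def Ball_def)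
qed

section \<open>The first summand as a subsheaf of finite type and rank 1\<close>

definition first_summand :: "('a, 'n::finite) atlas \<Rightarrow> 'a set \<Rightarrow> ('a \<Rightarrow> 'a \<times> (complex^2)) set" where
  "first_summand A S = {s \<in> sections A (trivial_bundle A) S. \<forall>x\<in>S. snd (s x) $ 2 = 0}"

text \<open>Over all of \<open>points A\<close>, this constant section is the one generator that
  serves both for finite type and for the lower bound on the rank.\<close>

definition first_unit :: "'a set \<Rightarrow> 'a \<Rightarrow> 'a \<times> (complex^2)" where
  "first_unit S = (\<lambda>x\<in>S. (x, axis 1 1))"

lemma sections_trivial_bundle:
  assumes "S \<subseteq> points A"
  shows "s \<in> sections A (trivial_bundle A) S \<longleftrightarrow>
    s \<in> extensional S \<and> (\<forall>x\<in>S. fst (s x) = x) \<and> (\<forall>i. holo_fun A (\<lambda>x. snd (s x) $ i) S)"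
proof -
  have "points A \<inter> S = S" using assms by blast
  moreover have "(\<forall>x\<in>S. s x \<in> fibre (trivial_bundle A) x) \<longleftrightarrow> (\<forall>x\<in>S. fst (s x) = x)"
    using assms by (intro ball_cong) (auto simp: mem_Times_iff)
  ultimately show ?thesis by (simp add: sections_def)
qed

lemma first_unit_in_first_summand:
  assumes A: "proper_atlas A" and S: "open_in A S"
  shows "first_unit S \<in> first_summand A S"
proof -
  have "holo_fun A (\<lambda>x. snd (first_unit S x) $ i) S" for i
    by (rule holo_fun_cong[OF A S, of "\<lambda>x. axis 1 1 $ i"])
      (auto simp: first_unit_def holo_fun_const)
  then show ?thesis
    unfolding first_summand_def sections_trivial_bundle[OF open_in_subset_points[OF S]] mem_Collect_eq
    by (auto simp: first_unit_def axis_def)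
qed

lemma subsheaf_first_summand:
  assumes A: "proper_atlas A"
  shows "subsheaf A (trivial_bundle A) (first_summand A)"
  unfolding subsheaf_def
proof (intro conjI allI impI)
  fix S assume "open_in A S"
  then show "first_summand A S \<subseteq> sections A (trivial_bundle A) S"
    by (auto simp: first_summand_def)
next
  fix S n f s u
  assume *: "open_in A S \<and> (\<forall>i<n. holo_fun A (f i) S \<and> s i \<in> first_summand A S) \<and>
      u \<in> sections A (trivial_bundle A) S \<and> lin_comb (trivial_bundle A) S u n f s"
  have "snd (u x) $ 2 = 0" if "x \<in> S" for x
  proof -
    have "x \<in> points A" using that * open_in_subset_points by blast
    then have "snd (u x) = (\<Sum>i<n. f i x *s snd (s i x))"
      using * that by (auto simp: lin_comb_def)
    then show ?thesis
      using * that by (auto simp: first_summand_def intro!: sum.neutral)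
  qed
  then show "u \<in> first_summand A S"
    using * by (auto simp: first_summand_def)
next
  fix S T s
  assume *: "open_in A S \<and> open_in A T \<and> T \<subseteq> S \<and> s \<in> first_summand A S"
  have "holo_fun A (\<lambda>x. snd (s x) $ i) T" for i
    using * holo_fun_subset[of A "\<lambda>x. snd (s x) $ i" S T]
    by (auto simp: first_summand_def sections_trivial_bundle[OF open_in_subset_points])
  then have "holo_fun A (\<lambda>x. snd (restrict s T x) $ i) T" for i
    using holo_fun_cong[OF A, of T "\<lambda>x. snd (s x) $ i"] * by auto
  then show "restrict s T \<in> first_summand A T"
    using * by (auto simp: first_summand_def sections_trivial_bundle[OF open_in_subset_points])
next
  fix C u
  assume *: "(\<forall>T\<in>C. open_in A T \<and> restrict u T \<in> first_summand A T) \<and>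
      u \<in> sections A (trivial_bundle A) (\<Union>C)"
  have "snd (u x) $ 2 = 0" if "x \<in> T" "T \<in> C" for x T
    using * that unfolding first_summand_def by force
  then show "u \<in> first_summand A (\<Union>C)"
    using * by (auto simp: first_summand_def)
qed

lemma first_summand_coordinate:
  assumes "open_in A S" "s \<in> first_summand A S" "x \<in> S"
  shows "snd (s x) = (snd (s x) $ 1) *s axis 1 1"
  using assms by (auto simp: first_summand_def vec_eq_iff forall_2 axis_def)

lemma holo_fun_first_summand:
  assumes "open_in A S" "s \<in> first_summand A S"
  shows "holo_fun A (\<lambda>x. snd (s x) $ i) S"
  using assms by (auto simp: first_summand_def sections_trivial_bundle[OF open_in_subset_points])

text \<open>One global generator suffices, since a section of the first summand is its first
  coordinate times \<open>first_unit\<close>. No shrinking of the open set is necessary.\<close>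

lemma finite_type_first_summand:
  assumes A: "proper_atlas A"
  shows "finite_type A (trivial_bundle A) (first_summand A)"
  unfolding finite_type_def
proof (intro ballI exI conjI allI impI)
  fix x assume "x \<in> points A"
  then show "x \<in> points A" .
  show "open_in A (points A)" using open_in_points[OF A] .
  show "first_unit (points A) \<in> first_summand A (points A)"
    using first_unit_in_first_summand[OF A open_in_points[OF A]] .
  fix T t y
  assume *: "open_in A T \<and> T \<subseteq> points A \<and> t \<in> first_summand A T \<and> y \<in> T"
  then show "open_in A T" "y \<in> T" "T \<subseteq> T" by auto
  show "holo_fun A (\<lambda>x. snd (t x) $ 1) T"
    using * holo_fun_first_summand by blast
  have "snd (t x) = snd (t x) $ 1 *s snd (first_unit (points A) x)" if "x \<in> T" for x
    using first_summand_coordinate[of A T t x] that * by (auto simp: first_unit_def)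
  then show "lin_comb (trivial_bundle A) T t 1 (\<lambda>i x. snd (t x) $ 1) (\<lambda>i. first_unit (points A))"
    by (auto simp: lin_comb_def)
qed

text \<open>Two sections with first coordinates \<open>a 0\<close> and \<open>a 1\<close> satisfy
  the relation with coefficients \<open>a 1\<close> and \<open>- a 0\<close>, because functions
  commute. Independence would force both coordinates, and hence both sections, to vanish near
  \<open>x\<close>; but zero sections are dependent.\<close>

lemma not_independent_first_summand:
  assumes A: "proper_atlas A"
  shows "\<not> has_independent_germs A (trivial_bundle A) (first_summand A) x 2"
proof
  assume "has_independent_germs A (trivial_bundle A) (first_summand A) x 2"
  then obtain S s where S: "open_in A S" "x \<in> S" and s: "\<And>i. i < 2 \<Longrightarrow> s i \<in> first_summand A S"
    and "germs_independent A (trivial_bundle A) x S 2 s"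
    unfolding has_independent_germs_def by blast
  then have ind: "\<exists>T'. open_in A T' \<and> x \<in> T' \<and> T' \<subseteq> T \<and> (\<forall>i<2. \<forall>y\<in>T'. f i y = 0)"
    if "open_in A T" "x \<in> T" "T \<subseteq> S" "\<And>i. i < 2 \<Longrightarrow> holo_fun A (f i) T"
      "\<And>y. y \<in> T \<Longrightarrow> (\<Sum>i<2. f i y *s snd (s i y)) = 0" for T f
    using that unfolding germs_independent_def by (simp add: Ball_def)
  define a where "a i y = snd (s i y) $ 1" for i y
  have sa: "snd (s i y) = a i y *s axis 1 1" if "i < 2" "y \<in> S" for i y
    using first_summand_coordinate[OF S(1) s] that by (simp add: a_def)
  have ha: "holo_fun A (a i) S" if "i < 2" for i
    using holo_fun_first_summand[OF S(1) s[OF that]] unfolding a_def .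
  have sum2: "(\<Sum>i<2. h i) = h 0 + h 1" for h :: "nat \<Rightarrow> complex^2"
    by (simp add: numeral_2_eq_2)
  define f where "f i = (if i = 0 then a 1 else (\<lambda>y. - a 0 y))" for i :: nat
  have "holo_fun A (f i) S" if "i < 2" for i
    using ha[of 0] ha[of 1] holo_fun_minus by (auto simp: f_def)
  moreover have "(\<Sum>i<2. f i y *s snd (s i y)) = 0" if "y \<in> S" for y
    using that by (simp add: sum2 sa vec_eq_iff f_def)
  ultimately have "\<exists>T. open_in A T \<and> x \<in> T \<and> T \<subseteq> S \<and> (\<forall>i<2. \<forall>y\<in>T. f i y = 0)"
    by (intro ind S order_refl)
  then obtain T where T: "open_in A T" "x \<in> T" "T \<subseteq> S" and T0: "\<forall>i<2. \<forall>y\<in>T. f i y = 0"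
    by (elim exE conjE)
  \<comment> \<open>Independence is used a second time, on the smaller set \<open>T\<close>: both
    sections are zero there, so the constant coefficients 1 form a relation and would have to vanish
    near \<open>x\<close>.\<close>
  have "(\<Sum>i<2. 1 *s snd (s i y)) = 0" if y: "y \<in> T" for y
  proof -
    have "a 1 y = 0" using T0[rule_format, of 0, OF _ y] by (simp add: f_def)
    moreover have "a 0 y = 0" using T0[rule_format, of 1, OF _ y] by (simp add: f_def)
    moreover have "y \<in> S" using y T(3) by blast
    ultimately show ?thesis by (simp add: sum2 sa)
  qed
  then have "\<exists>T'. open_in A T' \<and> x \<in> T' \<and> T' \<subseteq> T \<and> (\<forall>i<2::nat. \<forall>y\<in>T'. (1::complex) = 0)"
    by (intro ind T holo_fun_const)
  then obtain T' where "x \<in> T'" "\<forall>i<2::nat. \<forall>y\<in>T'. (1::complex) = 0"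
    by blast
  then show False by (metis one_neq_zero pos2)
qed

lemma sheaf_rank_first_summand:
  assumes A: "proper_atlas A"
  shows "sheaf_rank A (trivial_bundle A) (first_summand A) 1"
  unfolding sheaf_rank_def
proof (intro ballI conjI)
  fix x assume x: "x \<in> points A"
  have "f 0 y = 0" if "y \<in> T" "T \<subseteq> points A"
    "\<forall>y\<in>points A \<inter> T. f (0::nat) y *s snd (first_unit (points A) y) = 0" for T f y
  proof -
    have "(f 0 y *s snd (first_unit (points A) y)) $ 1 = 0"
      using that by (auto simp: subset_iff)
    moreover have "y \<in> points A" using that by blast
    ultimately show ?thesis by (simp add: first_unit_def)
  qed
  then have "germs_independent A (trivial_bundle A) x (points A) 1 (\<lambda>i. first_unit (points A))"
    unfolding germs_independent_def by (simp add: Ball_def) blast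
  then show "has_independent_germs A (trivial_bundle A) (first_summand A) x 1"
    unfolding has_independent_germs_def
    using x open_in_points[OF A] first_unit_in_first_summand[OF A open_in_points[OF A]]
    by (intro exI[of _ "points A"] exI[of _ "\<lambda>i. first_unit (points A)"]) auto
  show "\<not> has_independent_germs A (trivial_bundle A) (first_summand A) x (Suc 1)"
    using not_independent_first_summand[OF A] by (simp add: numeral_2_eq_2)
qed

lemma filtrable_trivial_bundle:
  assumes "proper_atlas A"
  shows "filtrable A (trivial_bundle A)"
  unfolding filtrable_def
  using subsheaf_first_summand finite_type_first_summand sheaf_rank_first_summand assms by blast


section \<open>The projectivized trivial bundle\<close>

definition affine_line :: "2 \<Rightarrow> complex \<Rightarrow> (complex^2) set" where
  "affine_line k u = cline (\<chi> i. if i = k then 1 else u)"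

lemma other_neq [simp]: "other k \<noteq> k"
  by (simp add: other_def)

lemma eq_other: "k' \<noteq> k \<Longrightarrow> k' = other k"
  by (metis exhaust_2 other_def)

lemma cline_in_affine_dom: "cline v \<in> affine_dom k \<longleftrightarrow> v $ k \<noteq> 0"
proof
  assume v: "v $ k \<noteq> 0"
  then have "cline v \<in> clines" unfolding clines_def by force
  moreover have "v \<in> cline v" unfolding cline_def by (rule range_eqI[of _ _ 1]) simp
  ultimately show "cline v \<in> affine_dom k" using v unfolding affine_dom_def by blast
next
  assume "cline v \<in> affine_dom k"
  then show "v $ k \<noteq> 0" unfolding affine_dom_def cline_def by force
qed

lemma affine_line_in_affine_dom: "affine_line k u \<in> affine_dom k"
  by (simp add: affine_line_def cline_in_affine_dom)

lemma affine_line_in_affine_dom': "k' \<noteq> k \<Longrightarrow> affine_line k u \<in> affine_dom k' \<longleftrightarrow> u \<noteq> 0"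
  by (simp add: affine_line_def cline_in_affine_dom)

lemma affine_coord_affine_line [simp]: "affine_coord k (affine_line k u) = u"
  by (simp add: affine_line_def affine_coord_cline)

lemma affine_coord_affine_line': "k' \<noteq> k \<Longrightarrow> u \<noteq> 0 \<Longrightarrow> affine_coord k' (affine_line k u) = inverse u"
  using eq_other[of k k'] by (auto simp: affine_line_def affine_coord_cline divide_inverse)

text \<open>Rescaling a spanning vector so that its entry \<open>k\<close> becomes 1 does not change
  the line. Together with \<open>affine_coord_affine_line\<close> this makes
  \<open>affine_line k\<close> the inverse of the chart \<open>affine_coord k\<close>.\<close>

lemma affine_line_affine_coord:
  assumes "L \<in> affine_dom k"
  shows "affine_line k (affine_coord k L) = L"
proof -
  obtain v where L: "L = cline v" using assms by (auto simp: affine_dom_def clines_def)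
  then have v: "v $ k \<noteq> 0" using assms by (simp add: cline_in_affine_dom)
  have "(\<chi> i. if i = k then 1 else v $ other k / v $ k) = inverse (v $ k) *s v"
    using v eq_other by (auto simp: vec_eq_iff divide_inverse)
  then have "affine_line k (affine_coord k L) = range (\<lambda>c. (c * inverse (v $ k)) *s v)"
    by (simp add: L affine_line_def affine_coord_cline[OF v]) (simp add: cline_def)
  also have "\<dots> = (\<lambda>c. c *s v) ` range (\<lambda>c. c * inverse (v $ k))"
    by (simp add: image_image)
  also have "range (\<lambda>c. c * inverse (v $ k)) = UNIV"
    using v by (intro surjI[of _ "\<lambda>c. c * v $ k"]) simp
  finally show ?thesis by (simp add: L cline_def)
qed

lemma clines_nonempty: "L \<in> clines \<Longrightarrow> L \<noteq> {}"
  by (auto simp: clines_def cline_def)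

lemma affine_dom_subset_clines: "affine_dom k \<subseteq> clines"
  by (auto simp: affine_dom_def)

section \<open>Charts of the projectivization in product form\<close>

definition prod_coord :: "complex^'n \<Rightarrow> complex \<Rightarrow> complex^('n::finite + 1)" where
  "prod_coord x u = (\<chi> i. case i of Inl j \<Rightarrow> x $ j | Inr _ \<Rightarrow> u)"

lemma prod_coord_nth [simp]:
  "prod_coord x u $ Inl j = x $ j" "prod_coord x u $ Inr b = u"
  by (simp_all add: prod_coord_def)

lemma proj_left_prod_coord [simp]: "proj_left (prod_coord x u) = x"
  by (simp add: vec_eq_iff)

lemma prod_coord_proj_left: "prod_coord (proj_left z) (z $ Inr 1) = z"
proof -
  have "prod_coord (proj_left z) (z $ Inr 1) $ i = z $ i" for i
  proof (cases i)
    case (Inr b)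
    moreover have "b = 1" by simp
    ultimately show ?thesis by simp
  qed simp
  then show ?thesis by (simp add: vec_eq_iff)
qed

lemma prod_coord_inject [simp]: "prod_coord x u = prod_coord y w \<longleftrightarrow> x = y \<and> u = w"
  by (metis prod_coord_nth(2) proj_left_prod_coord)

text \<open>Lines in the fibres of the trivial bundle are sets \<open>{p} \<times> L\<close>. The
  parameters \<open>c\<close> and \<open>k\<close> keep the origin of the chart, which the resulting
  pair of a set and a function need not determine.\<close>

definition proj_chart ::
    "('a, 'n::finite) atlas \<Rightarrow> ('a, 'n) chart \<Rightarrow> 2 \<Rightarrow> (('a \<times> (complex^2)) set, 'n + 1) chart" where
  "proj_chart A c k =
     ({{p} \<times> L | p L. p \<in> fst c \<and> L \<in> affine_dom k},
      \<lambda>\<ll>. prod_coord (snd c (proj_base (trivial_bundle A) \<ll>)) (affine_coord k (snd ` \<ll>)))"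

text \<open>The base point is a definite description through inclusion in a fibre. The empty set
  lies in every fibre, so uniqueness rests on \<open>L \<noteq> {}\<close>.\<close>

lemma proj_base_trivial_bundle:
  assumes "p \<in> points A" "L \<noteq> {}"
  shows "proj_base (trivial_bundle A :: ('a \<times> (complex^2), 'a, 2) vbundle) ({p} \<times> L) = p"
  unfolding proj_base_def
proof (rule the_equality)
  show "{p} \<times> L \<subseteq> fibre (trivial_bundle A) p" using assms by auto
  fix x assume "{p} \<times> L \<subseteq> fibre (trivial_bundle A) x"
  then show "x = p" using assms by (auto split: if_splits)
qed

lemma proj_points_trivial_bundle:
  "proj_points (trivial_bundle A :: ('a \<times> (complex^2), 'a, 2) vbundle)
    = {{p} \<times> L | p L. p \<in> points A \<and> L \<in> clines}"
proof -
  have "{e \<in> fibre (trivial_bundle A) p. snd e \<in> L} = {p} \<times> L"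
    if "p \<in> points A" for p and L :: "(complex^2) set"
    using that by auto
  then show ?thesis unfolding proj_points_def by (auto; blast)
qed

lemma proj_bundle_trivial_bundle:
  "proj_bundle A (trivial_bundle A) = {proj_chart A c k | c k. c \<in> A}"
proof -
  let ?E = "trivial_bundle A :: ('a \<times> (complex^2), 'a, 2) vbundle"
  have "{\<ll> \<in> proj_points ?E. proj_base ?E \<ll> \<in> U \<inter> points A \<and> snd ` \<ll> \<in> affine_dom k}
      = {{p} \<times> L | p L. p \<in> U \<and> L \<in> affine_dom k}"
    if "(U, \<phi>) \<in> A" for U k and \<phi> :: "'a \<Rightarrow> complex^'b"
  proof (intro equalityI subsetI)
    fix \<ll> assume "\<ll> \<in> {\<ll> \<in> proj_points ?E. proj_base ?E \<ll> \<in> U \<inter> points A \<and> snd ` \<ll> \<in> affine_dom k}"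
    then obtain p L where "\<ll> = {p} \<times> L" "p \<in> points A" "L \<in> clines"
      and *: "proj_base ?E \<ll> \<in> U" "snd ` \<ll> \<in> affine_dom k"
      unfolding proj_points_trivial_bundle by blast
    then show "\<ll> \<in> {{p} \<times> L | p L. p \<in> U \<and> L \<in> affine_dom k}"
      using proj_base_trivial_bundle[of p A L] clines_nonempty by (auto simp: snd_image_times)
  next
    fix \<ll> :: "('a \<times> (complex^2)) set" assume "\<ll> \<in> {{p} \<times> L | p L. p \<in> U \<and> L \<in> affine_dom k}"
    then obtain p L where *: "\<ll> = {p} \<times> L" "p \<in> U" "L \<in> affine_dom k" by blast
    moreover have "p \<in> points A" "L \<in> clines" "L \<noteq> {}"
      using * chart_subset_points[OF that] affine_dom_subset_clines clines_nonempty by blast+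
    ultimately show "\<ll> \<in> {\<ll> \<in> proj_points ?E. proj_base ?E \<ll> \<in> U \<inter> points A \<and> snd ` \<ll> \<in> affine_dom k}"
      using proj_base_trivial_bundle[of p A L]
      unfolding proj_points_trivial_bundle by (auto simp: snd_image_times)
  qed
  note dom = this
  show ?thesis
  proof (intro equalityI subsetI)
    fix c assume "c \<in> proj_bundle A ?E"
    then obtain U \<phi> k where "(U, \<phi>) \<in> A"
      "c = ({\<ll> \<in> proj_points ?E. proj_base ?E \<ll> \<in> U \<inter> points A \<and> snd ` \<ll> \<in> affine_dom k},
        \<lambda>\<ll>. prod_coord (\<phi> (proj_base ?E \<ll>)) (affine_coord k (snd ` \<ll>)))"
      by (auto simp: proj_bundle_def prod_coord_def)
    then have "c = proj_chart A (U, \<phi>) k" "(U, \<phi>) \<in> A"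
      using dom by (auto simp: proj_chart_def)
    then show "c \<in> {proj_chart A c k | c k. c \<in> A}" by blast
  next
    fix c assume "c \<in> {proj_chart A c k | c k. c \<in> A}"
    then obtain U \<phi> k where c: "(U, \<phi>) \<in> A" "c = proj_chart A (U, \<phi>) k" by auto
    have "c = ({\<ll> \<in> proj_points ?E. proj_base ?E \<ll> \<in> U \<inter> points A \<and> snd ` \<ll> \<in> affine_dom k},
        \<lambda>\<ll>. prod_coord (\<phi> (proj_base ?E \<ll>)) (affine_coord k (snd ` \<ll>)))"
      unfolding dom[OF c(1)] c(2) by (simp add: proj_chart_def)
    then show "c \<in> proj_bundle A ?E"
      using c(1) unfolding proj_bundle_def prod_coord_def by auto
  qed
qed

lemma proj_chart_eq:
  fixes A :: "('a, 'n::finite) atlas"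
  assumes "p \<in> points A" "L \<in> clines"
  shows "snd (proj_chart A (U, \<phi>) k) ({p} \<times> L) = prod_coord (\<phi> p) (affine_coord k L)"
  using assms clines_nonempty
  by (simp add: proj_chart_def proj_base_trivial_bundle snd_image_times)

context
  fixes A :: "('a, 'n::finite) atlas" and U :: "'a set" and \<phi> and k :: 2
  assumes A: "proper_atlas A" and c: "(U, \<phi>) \<in> A"
begin

lemma proj_chart_eq':
  assumes "p \<in> U" "L \<in> affine_dom k"
  shows "snd (proj_chart A (U, \<phi>) k) ({p} \<times> L) = prod_coord (\<phi> p) (affine_coord k L)"
  by (rule proj_chart_eq)
    (use assms chart_subset_points[OF c] affine_dom_subset_clines in blast)+

text \<open>The Jacobians in the transformation law involve \<open>inv_into\<close> of a chart. With
  this explicit inverse a transition map splits into one on the base and one on the projective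
  line.\<close>

lemma inv_proj_chart:
  assumes "proj_left w \<in> \<phi> ` U"
  shows "inv_into (fst (proj_chart A (U, \<phi>) k)) (snd (proj_chart A (U, \<phi>) k)) w
    = {inv_into U \<phi> (proj_left w)} \<times> affine_line k (w $ Inr 1)"
proof -
  let ?\<ll> = "{inv_into U \<phi> (proj_left w)} \<times> affine_line k (w $ Inr 1)"
  have inU: "inv_into U \<phi> (proj_left w) \<in> U" using assms by (rule inv_into_into)
  have inj: "inj_on \<phi> U" using A c by (auto simp: proper_atlas_def)
  have "inj_on (snd (proj_chart A (U, \<phi>) k)) (fst (proj_chart A (U, \<phi>) k))"
  proof (rule inj_onI)
    fix x y assume "x \<in> fst (proj_chart A (U, \<phi>) k)" "y \<in> fst (proj_chart A (U, \<phi>) k)"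
      and eq: "snd (proj_chart A (U, \<phi>) k) x = snd (proj_chart A (U, \<phi>) k) y"
    then obtain p L q M where *: "x = {p} \<times> L" "p \<in> U" "L \<in> affine_dom k"
      "y = {q} \<times> M" "q \<in> U" "M \<in> affine_dom k"
      by (auto simp: proj_chart_def)
    then have "\<phi> p = \<phi> q" "affine_coord k L = affine_coord k M"
      using eq by (auto simp: proj_chart_eq')
    moreover from this have "L = M"
      using *(3,6) affine_line_affine_coord by metis
    ultimately show "x = y" using * inj by (auto dest: inj_onD)
  qed
  moreover have "?\<ll> \<in> fst (proj_chart A (U, \<phi>) k)"
    using inU affine_line_in_affine_dom[of k] by (auto simp: proj_chart_def)
  moreover have "snd (proj_chart A (U, \<phi>) k) ?\<ll> = w"
    using inU assms by (simp add: proj_chart_eq' affine_line_in_affine_dom f_inv_into_f prod_coord_proj_left)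
  ultimately show ?thesis by (rule inv_into_f_eq)
qed

lemma proj_chart_image: "snd (proj_chart A (U, \<phi>) k) ` fst (proj_chart A (U, \<phi>) k) \<subseteq> {z. proj_left z \<in> \<phi> ` U}"
proof
  fix z assume "z \<in> snd (proj_chart A (U, \<phi>) k) ` fst (proj_chart A (U, \<phi>) k)"
  then obtain p L where "p \<in> U" "L \<in> affine_dom k" "z = snd (proj_chart A (U, \<phi>) k) ({p} \<times> L)"
    by (auto simp: proj_chart_def)
  then show "z \<in> {z. proj_left z \<in> \<phi> ` U}" by (simp add: proj_chart_eq')
qed

end


section \<open>The wedge product of a vector field on the base with one on the projective line\<close>

definition holomorphic_vector_field ::
    "('a, 'n::finite) atlas \<Rightarrow> (('a, 'n) chart \<Rightarrow> complex^'n \<Rightarrow> complex^'n) \<Rightarrow> bool" where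
  "holomorphic_vector_field A v \<longleftrightarrow>
     (\<forall>(U, \<phi>)\<in>A. \<forall>i. holo_on (\<lambda>z. v (U, \<phi>) z $ i) (\<phi> ` U)) \<and>
     (\<forall>(U, \<phi>)\<in>A. \<forall>(V, \<psi>)\<in>A. \<forall>p \<in> U \<inter> V.
        v (V, \<psi>) (\<psi> p) = jacobian (\<psi> \<circ> inv_into U \<phi>) (\<phi> p) *v v (U, \<phi>) (\<phi> p))"

definition vwedge :: "complex^'n \<Rightarrow> complex^'n \<Rightarrow> complex^'n^'n" where
  "vwedge a b = (\<chi> i j. a $ i * b $ j - b $ i * a $ j)"

text \<open>In matrix form \<open>vwedge a b\<close> is a b^T - b a^T, so conjugating by
  \<open>J\<close> just applies \<open>J\<close> to both vectors. The tensor law for a wedge product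
  thus follows from the vector law for its factors.\<close>

lemma vwedge_congruence:
  fixes J :: "complex^'n::finite^'m::finite"
  shows "J ** vwedge a b ** transpose J = vwedge (J *v a) (J *v b)"
proof -
  have "(\<Sum>y\<in>UNIV. (\<Sum>x\<in>UNIV. J $ i $ x * (a $ x * b $ y - b $ x * a $ y)) * J $ j $ y)
      = (\<Sum>x\<in>UNIV. J $ i $ x * a $ x) * (\<Sum>y\<in>UNIV. J $ j $ y * b $ y)
      - (\<Sum>x\<in>UNIV. J $ i $ x * b $ x) * (\<Sum>y\<in>UNIV. J $ j $ y * a $ y)" for i j
    unfolding sum_product sum_subtractf[symmetric]
    by (subst sum.swap) (simp add: sum_distrib_left algebra_simps)
  then show ?thesis
    by (simp add: vec_eq_iff matrix_matrix_mult_def transpose_def vwedge_def matrix_vector_mult_def)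
qed

lemma transpose_vwedge: "transpose (vwedge a b) = - vwedge a b"
  by (simp add: vec_eq_iff transpose_def vwedge_def)

text \<open>The coefficient of the vector field on the projective line that is \<open>\<partial>\<^sub>u\<close> in the chart
  \<open>u = v\<^sub>2 / v\<^sub>1\<close>, and hence \<open>- u\<^sup>2 \<partial>\<^sub>u\<close> in the chart \<open>u = v\<^sub>1 / v\<^sub>2\<close>.\<close>

definition line_coeff :: "2 \<Rightarrow> complex \<Rightarrow> complex" where
  "line_coeff k u = (if k = 1 then 1 else - u\<^sup>2)"

definition wedge_field ::
    "(complex^'n \<Rightarrow> complex^'n) \<Rightarrow> 2 \<Rightarrow> complex^('n::finite + 1) \<Rightarrow> complex^('n + 1)^('n + 1)" where
  "wedge_field v k z =
     vwedge (prod_coord (v (proj_left z)) 0) (prod_coord 0 (line_coeff k (z $ Inr 1)))"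

lemma wedge_field_nth:
  "wedge_field v k z $ Inl i $ Inl j = 0"
  "wedge_field v k z $ Inr a $ Inr b = 0"
  "wedge_field v k z $ Inl i $ Inr b = v (proj_left z) $ i * line_coeff k (z $ Inr 1)"
  "wedge_field v k z $ Inr b $ Inl i = - (v (proj_left z) $ i * line_coeff k (z $ Inr 1))"
  by (simp_all add: wedge_field_def vwedge_def)

lemma sum_UNIV_plus:
  fixes f :: "'n::finite + 1 \<Rightarrow> 'b::comm_monoid_add"
  shows "(\<Sum>l\<in>UNIV. f l) = (\<Sum>l\<in>UNIV. f (Inl l)) + f (Inr 1)"
  by (simp add: UNIV_Plus_UNIV[symmetric] sum.Plus)

lemma holo_on_line_coeff: "holo_on (\<lambda>z. line_coeff k (z $ i)) S"
  using holo_on_const[of 1 S] holo_on_minus[OF holo_on_mult[OF holo_on_nth[of i S] holo_on_nth[of i S]]]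
  by (cases "k = 1") (simp_all add: line_coeff_def power2_eq_square)

lemma all_plus_one: "(\<forall>i :: 'n + 1. P i) \<longleftrightarrow> (\<forall>i. P (Inl i)) \<and> P (Inr 1)"
  by (metis (full_types) num1_eq1 sum.exhaust)

lemma holo_on_wedge_field_Inl:
  assumes "\<And>i. holo_on (\<lambda>z. v z $ i) S" "proj_left ` T \<subseteq> S"
  shows "holo_on (\<lambda>z. v (proj_left z) $ i * line_coeff k (z $ Inr 1)) T"
  by (intro holo_on_mult holo_on_line_coeff holo_on_proj_left[OF assms])

lemma holo_on_wedge_field:
  assumes "\<And>i. holo_on (\<lambda>z. v z $ i) S" "proj_left ` T \<subseteq> S"
  shows "\<forall>i j. holo_on (\<lambda>z. wedge_field v k z $ i $ j) T"
  using holo_on_wedge_field_Inl[OF assms]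
  by (simp add: all_plus_one wedge_field_nth holo_on_const holo_on_minus)

text \<open>Only derivatives in the direction of the projective line enter, because the component of
  \<open>wedge_field v k\<close> in two base directions vanishes.\<close>

lemma schouten_wedge_field:
  assumes "\<And>i. holo_on (\<lambda>z. v z $ i) S" "proj_left z \<in> S"
  shows "schouten (wedge_field v k) (wedge_field v k) z i j l = 0"
proof -
  define h where "h = pderiv_at (Inr 1) (\<lambda>w. line_coeff k (w $ Inr 1)) z"
  let ?f = "\<lambda>i w. v (proj_left w) $ i * line_coeff k (w $ Inr 1)"
  have f: "holo_on (?f i) {z}" for i
    using holo_on_wedge_field_Inl[OF assms(1)] assms(2) by blast
  have neg: "pderiv_at m (\<lambda>w. - ?f i w) z = - pderiv_at m (?f i) z" for m i
    using pderiv_at_minus[OF f] by simp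
  have "proj_left (z + t *s axis (Inr 1) 1) = proj_left z" for t
    by (simp add: vec_eq_iff axis_def)
  moreover have "(\<lambda>t. line_coeff k ((z + t *s axis (Inr 1) 1) $ Inr 1)) field_differentiable at 0"
    by (rule holo_on_line_differentiable[OF holo_on_line_coeff UNIV_I])
  ultimately have d: "pderiv_at (Inr 1) (?f i) z = v (proj_left z) $ i * h" for i
    unfolding pderiv_at_def h_def by (simp only: deriv_cmult)
  \<comment> \<open>The indices are split into base indices and the line index. With exactly two
    base indices, the surviving terms contain the same product of two components of
    \<open>v\<close>, the line coefficient and \<open>h\<close>, with opposite signs. With exactly
    one, the derivatives along the base cancel by skew symmetry, which is the reason for having
    \<open>neg\<close> in all directions.\<close>
  have "\<forall>i j l. schouten (wedge_field v k) (wedge_field v k) z i j l = 0"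
    unfolding all_plus_one schouten_def sum_UNIV_plus wedge_field_nth pderiv_at_const neg d
    by (simp add: sum_negf algebra_simps)
  then show ?thesis by blast
qed

text \<open>The Jacobian is block diagonal: the base component of the transition map ignores the
  line coordinate and, as there is one global trivialization, the line component ignores the base
  point.\<close>

lemma jacobian_proj_chart:
  fixes A :: "('a, 'n::finite) atlas" and k k' :: 2
  assumes A: "proper_atlas A" and c: "(U, \<phi>) \<in> A" and p: "p \<in> U" and L: "L \<in> affine_dom k"
  shows "jacobian (snd (proj_chart A (V, \<psi>) k') \<circ>
        inv_into (fst (proj_chart A (U, \<phi>) k)) (snd (proj_chart A (U, \<phi>) k)))
        (prod_coord (\<phi> p) (affine_coord k L)) *v prod_coord x y
    = prod_coord (jacobian (\<psi> \<circ> inv_into U \<phi>) (\<phi> p) *v x)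
        (deriv (\<lambda>t. affine_coord k' (affine_line k t)) (affine_coord k L) * y)"
proof -
  define F where "F = snd (proj_chart A (V, \<psi>) k') \<circ>
    inv_into (fst (proj_chart A (U, \<phi>) k)) (snd (proj_chart A (U, \<phi>) k))"
  define z where "z = prod_coord (\<phi> p) (affine_coord k L)"
  have F: "F w = prod_coord (\<psi> (inv_into U \<phi> (proj_left w))) (affine_coord k' (affine_line k (w $ Inr 1)))"
    if w: "proj_left w \<in> \<phi> ` U" for w
  proof -
    have "inv_into U \<phi> (proj_left w) \<in> points A"
      using inv_into_into[OF w] chart_subset_points[OF c] by blast
    moreover have "affine_line k (w $ Inr 1) \<in> clines"
      using affine_line_in_affine_dom affine_dom_subset_clines by blast
    ultimately show ?thesis
      by (simp add: F_def inv_proj_chart[OF A c w] proj_chart_eq)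
  qed
  have opn: "open (\<phi> ` U)" using A c by (auto simp: proper_atlas_def)
  have lineL: "proj_left (z + t *s axis (Inl j) 1) = \<phi> p + t *s axis j 1" for t j
    by (simp add: vec_eq_iff axis_def z_def)
  have lineR: "proj_left (z + t *s axis (Inr 1) 1) = \<phi> p" for t
    by (simp add: vec_eq_iff axis_def z_def)
  have evL: "\<forall>\<^sub>F t in nhds 0. F (z + t *s axis (Inl j) 1) =
      prod_coord (\<psi> (inv_into U \<phi> (\<phi> p + t *s axis j 1))) (affine_coord k' (affine_line k (affine_coord k L)))" for j
    using eventually_line[OF opn imageI[OF p], of "axis j 1"]
    by eventually_elim (simp add: F lineL, simp add: z_def axis_def)
  have evR: "F (z + t *s axis (Inr 1) 1) =
      prod_coord (\<psi> (inv_into U \<phi> (\<phi> p))) (affine_coord k' (affine_line k (affine_coord k L + t)))" for t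
    using p by (simp add: F lineR) (simp add: z_def axis_def)
  have LL: "pderiv_at (Inl j) (\<lambda>w. F w $ Inl i) z = pderiv_at j (\<lambda>w. \<psi> (inv_into U \<phi> w) $ i) (\<phi> p)" for i j
    using evL[of j] by (intro pderiv_at_cong) (auto elim: eventually_mono)
  have LR: "pderiv_at (Inl j) (\<lambda>w. F w $ Inr 1) z = 0" for j
    using evL[of j] by (intro pderiv_at_eq[of _ _ _ "\<lambda>t. affine_coord k' (affine_line k (affine_coord k L))"])
      (auto elim: eventually_mono)
  have RL: "pderiv_at (Inr 1) (\<lambda>w. F w $ Inl i) z = 0" for i
    by (simp add: pderiv_at_def evR)
  have RR: "pderiv_at (Inr 1) (\<lambda>w. F w $ Inr 1) z
      = deriv (\<lambda>t. affine_coord k' (affine_line k t)) (affine_coord k L)"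
    by (simp add: pderiv_at_def evR deriv_shift_0[of _ "affine_coord k L"] comp_def)
  have "\<forall>i. (jacobian F z *v prod_coord x y) $ i = prod_coord (jacobian (\<psi> \<circ> inv_into U \<phi>) (\<phi> p) *v x)
        (deriv (\<lambda>t. affine_coord k' (affine_line k t)) (affine_coord k L) * y) $ i"
    unfolding all_plus_one
    by (simp add: jacobian_def matrix_vector_mult_def sum_UNIV_plus LL LR RL RR)
  then show ?thesis unfolding F_def z_def by (simp add: vec_eq_iff)
qed

text \<open>The change of affine coordinate is u \<mapsto> 1/u with derivative -1/u^2. It carries
  the coefficient 1 to minus the square of the new coordinate, and -u^2 to 1.\<close>

lemma line_coeff_transition:
  assumes L: "L \<in> affine_dom k" "L \<in> affine_dom k'"
  shows "deriv (\<lambda>t. affine_coord k' (affine_line k t)) (affine_coord k L) * line_coeff k (affine_coord k L)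
    = line_coeff k' (affine_coord k' L)"
proof (cases "k' = k")
  case False
  define u where "u = affine_coord k L"
  have L_eq: "L = affine_line k u" using affine_line_affine_coord[OF L(1)] by (simp add: u_def)
  then have u: "u \<noteq> 0" using L(2) affine_line_in_affine_dom'[OF False] by blast
  have "\<forall>\<^sub>F t in nhds u. affine_coord k' (affine_line k t) = inverse t"
    using t1_space_nhds[OF u] by eventually_elim (rule affine_coord_affine_line'[OF False])
  then have "deriv (\<lambda>t. affine_coord k' (affine_line k t)) u = deriv inverse u"
    by (rule deriv_cong_ev) simp
  also have "\<dots> = - inverse (u\<^sup>2)"
    using DERIV_inverse[OF u, of UNIV] by (intro DERIV_imp_deriv) (simp add: power_inverse numeral_2_eq_2)
  finally have "deriv (\<lambda>t. affine_coord k' (affine_line k t)) u = - inverse (u\<^sup>2)" .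
  moreover have "affine_coord k' L = inverse u"
    using affine_coord_affine_line'[OF False u] by (simp add: L_eq)
  moreover have "(k = 1) \<noteq> (k' = 1)"
    using False by (metis exhaust_2)
  ultimately show ?thesis
    using u unfolding u_def[symmetric] by (auto simp: line_coeff_def power_inverse)
qed simp

lemma wedge_field_transition:
  fixes A :: "('a, 'n::finite) atlas" and k k' :: 2
  assumes A: "proper_atlas A" and v: "holomorphic_vector_field A v"
    and c: "(U, \<phi>) \<in> A" and d: "(V, \<psi>) \<in> A"
    and \<ll>: "\<ll> \<in> fst (proj_chart A (U, \<phi>) k)" "\<ll> \<in> fst (proj_chart A (V, \<psi>) k')"
  defines "J \<equiv> jacobian (snd (proj_chart A (V, \<psi>) k') \<circ>
      inv_into (fst (proj_chart A (U, \<phi>) k)) (snd (proj_chart A (U, \<phi>) k)))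
      (snd (proj_chart A (U, \<phi>) k) \<ll>)"
  shows "wedge_field (v (V, \<psi>)) k' (snd (proj_chart A (V, \<psi>) k') \<ll>)
    = J ** wedge_field (v (U, \<phi>)) k (snd (proj_chart A (U, \<phi>) k) \<ll>) ** transpose J"
proof -
  obtain p L where pL: "\<ll> = {p} \<times> L" "p \<in> U" "L \<in> affine_dom k"
    using \<ll>(1) by (auto simp: proj_chart_def)
  obtain q M where qM: "\<ll> = {q} \<times> M" "q \<in> V" "M \<in> affine_dom k'"
    using \<ll>(2) by (auto simp: proj_chart_def)
  \<comment> \<open>A product \<open>{p} \<times> L\<close> determines \<open>p\<close> and
    \<open>L\<close> only when \<open>L\<close> is non-empty.\<close>
  have "L \<noteq> {}" using pL affine_dom_subset_clines clines_nonempty by blast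
  then have "q = p" "M = L" using pL(1) qM(1) by (auto simp: times_eq_iff)
  then have V: "p \<in> V" "L \<in> affine_dom k'" using qM by auto
  have vt: "v (V, \<psi>) (\<psi> p) = jacobian (\<psi> \<circ> inv_into U \<phi>) (\<phi> p) *v v (U, \<phi>) (\<phi> p)"
    using v c d pL(2) V(1) unfolding holomorphic_vector_field_def by fast
  have J: "J *v prod_coord x y = prod_coord (jacobian (\<psi> \<circ> inv_into U \<phi>) (\<phi> p) *v x)
      (deriv (\<lambda>t. affine_coord k' (affine_line k t)) (affine_coord k L) * y)" for x y
    unfolding J_def pL(1) proj_chart_eq'[OF A c pL(2,3)]
    by (rule jacobian_proj_chart[OF A c pL(2,3)])
  show ?thesis
    unfolding wedge_field_def vwedge_congruence J
    unfolding pL(1) proj_chart_eq'[OF A c pL(2,3)] proj_chart_eq'[OF A d V]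
    by (simp add: vt line_coeff_transition[OF pL(3) V(2)] matrix_vector_mult_0_right)
qed

definition wedge_bivector :: "('a, 'n::finite) atlas \<Rightarrow> (('a, 'n) chart \<Rightarrow> complex^'n \<Rightarrow> complex^'n) \<Rightarrow>
    (('a \<times> (complex^2)) set, 'n + 1) chart \<Rightarrow> complex^('n + 1) \<Rightarrow> complex^('n + 1)^('n + 1)" where
  "wedge_bivector A v C =
     (let (c, k) = (SOME (c, k). c \<in> A \<and> C = proj_chart A c k) in wedge_field (v c) k)"

text \<open>A chart of the projectivization may arise from several charts of the base. Whichever of them
  is picked, the transformation law holds.\<close>

lemma wedge_bivector_cases:
  assumes "C \<in> proj_bundle A (trivial_bundle A)"
  obtains U \<phi> k where "(U, \<phi>) \<in> A" "C = proj_chart A (U, \<phi>) k"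
    "wedge_bivector A v C = wedge_field (v (U, \<phi>)) k"
proof -
  define ck where "ck = (SOME (c, k). c \<in> A \<and> C = proj_chart A c k)"
  have "\<exists>ck. case ck of (c, k) \<Rightarrow> c \<in> A \<and> C = proj_chart A c k"
    using assms unfolding proj_bundle_trivial_bundle by auto
  then have "case ck of (c, k) \<Rightarrow> c \<in> A \<and> C = proj_chart A c k"
    unfolding ck_def by (rule someI_ex)
  moreover obtain U \<phi> k where ck: "ck = ((U, \<phi>), k)" by (metis surj_pair)
  moreover have "wedge_bivector A v C = (let (c, k) = ck in wedge_field (v c) k)"
    unfolding wedge_bivector_def ck_def ..
  ultimately show ?thesis
    by (intro that[of U \<phi> k]) simp_all
qed

lemma poisson_wedge_bivector:
  assumes A: "proper_atlas A" and v: "holomorphic_vector_field A v"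
  shows "poisson_structure (proj_bundle A (trivial_bundle A)) (wedge_bivector A v)"
  unfolding poisson_structure_def holomorphic_bivector_def case_prod_unfold Let_def prod.collapse
proof (intro conjI ballI allI)
  fix C assume "C \<in> proj_bundle A (trivial_bundle A)"
  then obtain U \<phi> k where c: "(U, \<phi>) \<in> A" and C: "C = proj_chart A (U, \<phi>) k"
    and w: "wedge_bivector A v C = wedge_field (v (U, \<phi>)) k"
    by (rule wedge_bivector_cases)
  have holo: "holo_on (\<lambda>z. v (U, \<phi>) z $ i) (\<phi> ` U)" for i
    using v c unfolding holomorphic_vector_field_def by fast
  have im: "proj_left ` (snd C ` fst C) \<subseteq> \<phi> ` U"
    using proj_chart_image[OF A c] unfolding C by blast
  show "holo_on (\<lambda>z. wedge_bivector A v C z $ i $ j) (snd C ` fst C)" for i j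
    using holo_on_wedge_field[OF holo im] unfolding w by blast
  show "transpose (wedge_bivector A v C z) = - wedge_bivector A v C z" for z
    unfolding w wedge_field_def by (rule transpose_vwedge)
  show "schouten (wedge_bivector A v C) (wedge_bivector A v C) z i j l = 0"
    if "z \<in> snd C ` fst C" for z i j l
    using schouten_wedge_field[OF holo] im that unfolding w by blast
  fix D \<ll> assume "D \<in> proj_bundle A (trivial_bundle A)" and \<ll>: "\<ll> \<in> fst C \<inter> fst D"
  then obtain V \<psi> l where d: "(V, \<psi>) \<in> A" and D: "D = proj_chart A (V, \<psi>) l"
    and w': "wedge_bivector A v D = wedge_field (v (V, \<psi>)) l"
    using wedge_bivector_cases by metis
  show "wedge_bivector A v D (snd D \<ll>) =
      jacobian (snd D \<circ> inv_into (fst C) (snd C)) (snd C \<ll>) ** wedge_bivector A v C (snd C \<ll>) **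
      transpose (jacobian (snd D \<circ> inv_into (fst C) (snd C)) (snd C \<ll>))"
    using wedge_field_transition[OF A v c d] \<ll> unfolding w w' unfolding C D by blast
qed

text \<open>The line with coordinate 0 in the first affine chart is a good test point, because the
  coefficient of the field on the projective line is 1 there. What has to be bridged is that
  \<open>wedge_bivector\<close> may have picked other data for the same chart.\<close>

lemma nonzero_wedge_bivector:
  assumes A: "proper_atlas A" and v: "holomorphic_vector_field A v"
    and c: "(U, \<phi>) \<in> A" "p \<in> U" "v (U, \<phi>) (\<phi> p) \<noteq> 0"
  shows "nonzero_bivector (proj_bundle A (trivial_bundle A)) (wedge_bivector A v)"
proof -
  define C where "C = proj_chart A (U, \<phi>) 1"
  define \<ll> where "\<ll> = {p} \<times> affine_line 1 0"
  have C: "C \<in> proj_bundle A (trivial_bundle A)"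
    using c unfolding C_def proj_bundle_trivial_bundle by blast
  then obtain V \<psi> k where d: "(V, \<psi>) \<in> A" and C': "C = proj_chart A (V, \<psi>) k"
    and w: "wedge_bivector A v C = wedge_field (v (V, \<psi>)) k"
    by (rule wedge_bivector_cases)
  have \<ll>: "\<ll> \<in> fst C"
    using c(2) affine_line_in_affine_dom by (auto simp: C_def \<ll>_def proj_chart_def)
  obtain i where "v (U, \<phi>) (\<phi> p) $ i \<noteq> 0" using c(3) by (auto simp: vec_eq_iff)
  then have "wedge_field (v (U, \<phi>)) 1 (snd C \<ll>) $ Inl i $ Inr 1 \<noteq> 0"
    unfolding C_def \<ll>_def proj_chart_eq'[OF A c(1,2) affine_line_in_affine_dom] wedge_field_nth
    by (simp add: line_coeff_def)
  then have "wedge_field (v (U, \<phi>)) 1 (snd C \<ll>) \<noteq> 0" by (metis zero_index)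
  \<comment> \<open>The transformation law from the picked data to the given data, both describing
    \<open>C\<close>, would send a zero matrix to a zero matrix.\<close>
  then have "wedge_field (v (V, \<psi>)) k (snd C \<ll>) \<noteq> 0"
    using wedge_field_transition[OF A v d c(1), of \<ll> k 1] \<ll>
    unfolding C_def[symmetric] C'[symmetric] by auto
  then show ?thesis
    unfolding nonzero_bivector_def w[symmetric] using C \<ll> by (intro bexI[of _ C]) (auto simp: split_beta)
qed


section \<open>Quotients of punctured line bundles\<close>

text \<open>The quotient is studied over an arbitrary base atlas. \<open>open_dom\<close> expresses
  that chart domains are open as seen from all other charts; openness of the annuli below relies on
  it.\<close>

locale punctured_line_bundle_quotient =
  fixes B :: "('a, 'n::finite) atlas" and \<Theta> :: "('e, 'a, 1) vbundle" and \<tau> :: complex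
  assumes proper: "proper_atlas B"
    and open_dom: "\<And>U \<phi>. (U, \<phi>) \<in> B \<Longrightarrow> open_in B U"
    and nonempty: "points B \<noteq> {}"
    and holomorphic: "holomorphic_vector_bundle B \<Theta>"
    and tau: "1 < cmod \<tau>"
begin

abbreviation "dilate \<equiv> fibre_scale \<Theta>"
abbreviation "q \<equiv> orbit \<Theta> \<tau>"
abbreviation "Z \<equiv> zero_section_compl \<Theta>"

definition total_dom :: "'a set \<Rightarrow> 'a set \<Rightarrow> 'e set" where
  "total_dom U V = {e \<in> Z. prj \<Theta> e \<in> U \<inter> V}"

definition total_coord :: "('a \<Rightarrow> complex^'n) \<Rightarrow> ('e \<Rightarrow> complex^1) \<Rightarrow> 'e \<Rightarrow> complex^('n + 1)" where
  "total_coord \<phi> \<psi> e = prod_coord (\<phi> (prj \<Theta> e)) (\<psi> e $ 1)"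

definition P :: "('e, 'n + 1) atlas" where
  "P = open_submanifold (total_atlas B \<Theta>) Z"

lemma
  shows prj_tot: "prj \<Theta> ` tot \<Theta> \<subseteq> points B"
    and triv_cover: "\<Union> (fst ` trivs \<Theta>) = points B"
    and triv_aux: "\<forall>(V, \<psi>)\<in>trivs \<Theta>. open_in B V \<and> (\<forall>x\<in>V. bij_betw \<psi> (fibre \<Theta> x) UNIV)"
    and transition_aux: "\<forall>(V, \<psi>)\<in>trivs \<Theta>. \<forall>(V', \<psi>')\<in>trivs \<Theta>. \<exists>g :: 'a \<Rightarrow> complex^1^1.
        (\<forall>i j. holo_fun B (\<lambda>x. g x $ i $ j) (V \<inter> V')) \<and>
        (\<forall>x \<in> V \<inter> V'. \<forall>e \<in> fibre \<Theta> x. \<psi>' e = g x *v \<psi> e)"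
  using holomorphic unfolding holomorphic_vector_bundle_def by - (elim conjE, assumption)+

lemma prj_in_points: "e \<in> tot \<Theta> \<Longrightarrow> prj \<Theta> e \<in> points B"
  using prj_tot by blast

lemma triv_at:
  assumes "x \<in> points B"
  obtains V \<psi> where "(V, \<psi>) \<in> trivs \<Theta>" "x \<in> V"
proof -
  have "x \<in> \<Union> (fst ` trivs \<Theta>)"
    using assms triv_cover by simp
  then show ?thesis using that by auto
qed

lemma chart_at:
  assumes "x \<in> points B"
  obtains U \<phi> where "(U, \<phi>) \<in> B" "x \<in> U"
  using assms unfolding points_def by auto

lemma triv_open: "(V, \<psi>) \<in> trivs \<Theta> \<Longrightarrow> open_in B V"
  using triv_aux by auto

lemma triv_bij: "(V, \<psi>) \<in> trivs \<Theta> \<Longrightarrow> x \<in> V \<Longrightarrow> bij_betw \<psi> (fibre \<Theta> x) UNIV"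
  using triv_aux by auto

lemma transition_matrix:
  assumes "(V, \<psi>) \<in> trivs \<Theta>" "(V', \<psi>') \<in> trivs \<Theta>"
  obtains g :: "'a \<Rightarrow> complex^1^1" where
    "\<forall>i j. holo_fun B (\<lambda>x. g x $ i $ j) (V \<inter> V')"
    "\<forall>e \<in> tot \<Theta>. prj \<Theta> e \<in> V \<inter> V' \<longrightarrow> \<psi>' e = g (prj \<Theta> e) *v \<psi> e"
proof -
  have "\<exists>g :: 'a \<Rightarrow> complex^1^1. (\<forall>i j. holo_fun B (\<lambda>x. g x $ i $ j) (V \<inter> V')) \<and>
      (\<forall>x \<in> V \<inter> V'. \<forall>e \<in> fibre \<Theta> x. \<psi>' e = g x *v \<psi> e)"
    using transition_aux[rule_format, OF assms(1), unfolded prod.case, rule_format, OF assms(2)]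
    by (simp only: prod.case)
  then show ?thesis using that unfolding fibre_def by blast
qed

section \<open>Fibrewise scaling and the orbits of \<tau>\<close>

lemma in_tot_eqI:
  assumes "(V, \<psi>) \<in> trivs \<Theta>" "e \<in> tot \<Theta>" "e' \<in> tot \<Theta>" "prj \<Theta> e = prj \<Theta> e'" "prj \<Theta> e \<in> V"
    and "\<psi> e = \<psi> e'"
  shows "e = e'"
proof -
  have "inj_on \<psi> (fibre \<Theta> (prj \<Theta> e))"
    using triv_bij assms by (auto simp: bij_betw_def)
  moreover have "e \<in> fibre \<Theta> (prj \<Theta> e)" "e' \<in> fibre \<Theta> (prj \<Theta> e)"
    using assms by (auto simp: fibre_def)
  ultimately show ?thesis using assms(6) by (auto dest: inj_onD)
qed

lemma in_tot_ex:
  assumes "(V, \<psi>) \<in> trivs \<Theta>" "x \<in> V"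
  obtains e where "e \<in> tot \<Theta>" "prj \<Theta> e = x" "\<psi> e = w"
proof -
  have "w \<in> \<psi> ` fibre \<Theta> x" using triv_bij[OF assms] by (auto simp: bij_betw_def)
  then show ?thesis using that by (auto simp: fibre_def)
qed

text \<open>Transition matrices commute with scalars, so an element scaled in one trivialization is
  scaled in all of them; bijectivity on fibres makes it unique. This validates the definite
  description in \<open>fibre_scale\<close>.\<close>

lemma dilate_aux:
  assumes e: "e \<in> tot \<Theta>"
  shows "dilate c e \<in> fibre \<Theta> (prj \<Theta> e) \<and>
    (\<forall>(V, \<psi>)\<in>trivs \<Theta>. prj \<Theta> e \<in> V \<longrightarrow> \<psi> (dilate c e) = c *s \<psi> e)"
proof -
  obtain V \<psi> where V: "(V, \<psi>) \<in> trivs \<Theta>" "prj \<Theta> e \<in> V"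
    using triv_at[OF prj_in_points[OF e]] .
  obtain e' where e': "e' \<in> tot \<Theta>" "prj \<Theta> e' = prj \<Theta> e" "\<psi> e' = c *s \<psi> e"
    using in_tot_ex[OF V] .
  have "\<psi>' e' = c *s \<psi>' e" if V': "(V', \<psi>') \<in> trivs \<Theta>" "prj \<Theta> e \<in> V'" for V' \<psi>'
  proof -
    obtain g where g: "\<forall>e \<in> tot \<Theta>. prj \<Theta> e \<in> V \<inter> V' \<longrightarrow> \<psi>' e = (g (prj \<Theta> e) :: complex^1^1) *v \<psi> e"
      using transition_matrix[OF V(1) V'(1)] .
    show ?thesis
      using g e e' V(2) V'(2) by (simp add: vector_scalar_commute)
  qed
  then have "e' \<in> fibre \<Theta> (prj \<Theta> e) \<and> (\<forall>(V, \<psi>)\<in>trivs \<Theta>. prj \<Theta> e \<in> V \<longrightarrow> \<psi> e' = c *s \<psi> e)"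
    using e' by (auto simp: fibre_def)
  moreover have "e'' = e'" if "e'' \<in> fibre \<Theta> (prj \<Theta> e) \<and>
      (\<forall>(V, \<psi>)\<in>trivs \<Theta>. prj \<Theta> e \<in> V \<longrightarrow> \<psi> e'' = c *s \<psi> e)" for e''
    using that V e' by (intro in_tot_eqI[OF V(1)]) (auto simp: fibre_def)
  ultimately show ?thesis
    unfolding fibre_scale_def by (rule theI)
qed

lemma dilate_in_tot [simp]: "e \<in> tot \<Theta> \<Longrightarrow> dilate c e \<in> tot \<Theta>"
  and prj_dilate [simp]: "e \<in> tot \<Theta> \<Longrightarrow> prj \<Theta> (dilate c e) = prj \<Theta> e"
  using dilate_aux[of e c] by (auto simp: fibre_def)

lemma triv_dilate:
  "(V, \<psi>) \<in> trivs \<Theta> \<Longrightarrow> e \<in> tot \<Theta> \<Longrightarrow> prj \<Theta> e \<in> V \<Longrightarrow> \<psi> (dilate c e) = c *s \<psi> e"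
  using dilate_aux[of e c] by auto

lemma dilate_dilate:
  assumes e: "e \<in> tot \<Theta>"
  shows "dilate c (dilate d e) = dilate (c * d) e"
proof -
  obtain V \<psi> where V: "(V, \<psi>) \<in> trivs \<Theta>" "prj \<Theta> e \<in> V"
    using triv_at[OF prj_in_points[OF e]] .
  show ?thesis
    by (rule in_tot_eqI[OF V(1)]) (use e V in \<open>simp_all add: triv_dilate\<close>)
qed

lemma dilate_1:
  assumes e: "e \<in> tot \<Theta>"
  shows "dilate 1 e = e"
proof -
  obtain V \<psi> where V: "(V, \<psi>) \<in> trivs \<Theta>" "prj \<Theta> e \<in> V"
    using triv_at[OF prj_in_points[OF e]] .
  show ?thesis
    by (rule in_tot_eqI[OF V(1)]) (use e V in \<open>simp_all add: triv_dilate\<close>)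
qed

lemma tau_nonzero: "\<tau> \<noteq> 0"
  using tau by auto

lemma orbit_eqD:
  assumes e: "e \<in> tot \<Theta>" "e' \<in> tot \<Theta>" and eq: "q e = q e'"
  obtains m where "e' = dilate (\<tau> powi m) e"
proof -
  have "dilate (\<tau> powi 0) e' \<in> q e'" unfolding orbit_def by blast
  then have "e' \<in> q e" using dilate_1[OF e(2)] eq by simp
  then show ?thesis using that by (auto simp: orbit_def)
qed

lemma orbit_dilate:
  assumes e: "e \<in> tot \<Theta>"
  shows "q (dilate (\<tau> powi m) e) = q e"
proof -
  have *: "dilate (\<tau> powi k) (dilate (\<tau> powi m) e) = dilate (\<tau> powi (k + m)) e" for k
    using e tau_nonzero by (simp add: dilate_dilate power_int_add)
  have "dilate (\<tau> powi k) e = dilate (\<tau> powi (k - m)) (dilate (\<tau> powi m) e)" for k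
    by (simp add: *)
  then show ?thesis unfolding orbit_def using * by blast
qed

text \<open>Scaling by \<open>c\<close> commutes with scaling by powers of \<tau>, so it descends to
  orbits. This is what allows different lifts of a point to be moved together.\<close>

lemma orbit_dilate_cong:
  assumes e: "e \<in> tot \<Theta>" "e' \<in> tot \<Theta>" and eq: "q e = q e'"
  shows "q (dilate c e) = q (dilate c e')"
proof -
  obtain m where "e' = dilate (\<tau> powi m) e" using orbit_eqD[OF assms] .
  then have "dilate c e' = dilate (\<tau> powi m) (dilate c e)"
    using e by (simp add: dilate_dilate mult.commute)
  then show ?thesis using orbit_dilate e by simp
qed

section \<open>Coordinates on the complement of the zero section\<close>

lemma zero_section_compl_subset: "Z \<subseteq> tot \<Theta>"
  by (auto simp: zero_section_compl_def)

lemma zero_section_complD: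
  "e \<in> Z \<Longrightarrow> (V, \<psi>) \<in> trivs \<Theta> \<Longrightarrow> prj \<Theta> e \<in> V \<Longrightarrow> \<psi> e $ 1 \<noteq> 0"
  unfolding zero_section_compl_def by (auto simp: vec_eq_iff)

text \<open>Transition maps are linear: a zero in another trivialization would be mapped to a zero
  in this one.\<close>

lemma zero_section_complI:
  assumes V: "(V, \<psi>) \<in> trivs \<Theta>" "e \<in> tot \<Theta>" "prj \<Theta> e \<in> V" "\<psi> e \<noteq> 0"
  shows "e \<in> Z"
proof -
  have "\<psi>' e \<noteq> 0" if V': "(V', \<psi>') \<in> trivs \<Theta>" "prj \<Theta> e \<in> V'" for V' \<psi>'
  proof
    obtain g where g: "\<forall>e \<in> tot \<Theta>. prj \<Theta> e \<in> V' \<inter> V \<longrightarrow> \<psi> e = (g (prj \<Theta> e) :: complex^1^1) *v \<psi>' e"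
      using transition_matrix[OF V'(1) V(1)] .
    assume "\<psi>' e = 0"
    then show False using g V V'(2) by (simp add: matrix_vector_mult_0_right)
  qed
  then show ?thesis using V by (auto simp: zero_section_compl_def)
qed

lemma P_eq:
  "P = {(total_dom U V, total_coord \<phi> \<psi>) | U \<phi> V \<psi>. (U, \<phi>) \<in> B \<and> (V, \<psi>) \<in> trivs \<Theta>}"
proof -
  have 1: "{e \<in> tot \<Theta>. prj \<Theta> e \<in> U \<inter> V} \<inter> Z = total_dom U V" for U V
    using zero_section_compl_subset by (auto simp: total_dom_def)
  have "(\<chi> i. case i of Inl k \<Rightarrow> \<phi> (prj \<Theta> e) $ k | Inr k \<Rightarrow> \<psi> e $ k) = total_coord \<phi> \<psi> e"
    for \<phi> \<psi> e
    unfolding vec_eq_iff all_plus_one by (simp add: total_coord_def)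
  then have 2: "(\<lambda>e. \<chi> i. case i of Inl k \<Rightarrow> \<phi> (prj \<Theta> e) $ k | Inr k \<Rightarrow> \<psi> e $ k) = total_coord \<phi> \<psi>"
    for \<phi> \<psi>
    by blast
  have 3: "total_atlas B \<Theta> = {({e \<in> tot \<Theta>. prj \<Theta> e \<in> U \<inter> V}, total_coord \<phi> \<psi>)
      | U \<phi> V \<psi>. (U, \<phi>) \<in> B \<and> (V, \<psi>) \<in> trivs \<Theta>}"
    unfolding total_atlas_def 2 ..
  show ?thesis
  proof (intro equalityI subsetI)
    fix c assume "c \<in> P"
    then obtain W \<Phi> where c: "c = (W \<inter> Z, \<Phi>)" and "(W, \<Phi>) \<in> total_atlas B \<Theta>"
      unfolding P_def open_submanifold_def by auto
    then obtain U \<phi> V \<psi> where *: "(U, \<phi>) \<in> B" "(V, \<psi>) \<in> trivs \<Theta>"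
      and W: "W = {e \<in> tot \<Theta>. prj \<Theta> e \<in> U \<inter> V}" "\<Phi> = total_coord \<phi> \<psi>"
      unfolding 3 by auto
    have "c = (total_dom U V, total_coord \<phi> \<psi>)" unfolding c W 1 ..
    then show "c \<in> {(total_dom U V, total_coord \<phi> \<psi>) | U \<phi> V \<psi>. (U, \<phi>) \<in> B \<and> (V, \<psi>) \<in> trivs \<Theta>}"
      using * by blast
  next
    fix c assume "c \<in> {(total_dom U V, total_coord \<phi> \<psi>) | U \<phi> V \<psi>. (U, \<phi>) \<in> B \<and> (V, \<psi>) \<in> trivs \<Theta>}"
    then obtain U \<phi> V \<psi> where *: "(U, \<phi>) \<in> B" "(V, \<psi>) \<in> trivs \<Theta>"
      and c: "c = (total_dom U V, total_coord \<phi> \<psi>)"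
      by blast
    have "({e \<in> tot \<Theta>. prj \<Theta> e \<in> U \<inter> V}, total_coord \<phi> \<psi>) \<in> total_atlas B \<Theta>"
      unfolding 3 using * by blast
    then show "c \<in> P"
      unfolding P_def open_submanifold_def c 1[symmetric] by blast
  qed
qed

lemma P_chart: "(U, \<phi>) \<in> B \<Longrightarrow> (V, \<psi>) \<in> trivs \<Theta> \<Longrightarrow> (total_dom U V, total_coord \<phi> \<psi>) \<in> P"
  unfolding P_eq by blast

lemma total_coord_inject:
  assumes "(U, \<phi>) \<in> B" "(V, \<psi>) \<in> trivs \<Theta>" "e \<in> tot \<Theta>" "e' \<in> tot \<Theta>"
    and "prj \<Theta> e \<in> U \<inter> V" "prj \<Theta> e' \<in> U \<inter> V" "total_coord \<phi> \<psi> e = total_coord \<phi> \<psi> e'"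
  shows "e = e'"
proof -
  have "\<phi> (prj \<Theta> e) = \<phi> (prj \<Theta> e')" "\<psi> e $ 1 = \<psi> e' $ 1"
    using assms(7) by (simp_all add: total_coord_def)
  moreover from this(2) have "\<psi> e = \<psi> e'"
    by (simp add: vec_eq_iff)
  moreover have "inj_on \<phi> U" using proper assms(1) by (auto simp: proper_atlas_def)
  ultimately show ?thesis using assms by (intro in_tot_eqI[OF assms(2)]) (auto dest: inj_onD)
qed

text \<open>Scaling by \<open>1 + t * a\<close> draws a straight line in the fibre direction.
  Partial derivatives in that direction can therefore be computed by moving points of the bundle
  instead of coordinates.\<close>

lemma total_coord_dilate:
  assumes "(V, \<psi>) \<in> trivs \<Theta>" "e \<in> tot \<Theta>" "prj \<Theta> e \<in> V"
  shows "total_coord \<phi> \<psi> (dilate (1 + t * a) e)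
    = total_coord \<phi> \<psi> e + t *s axis (Inr 1) (a * \<psi> e $ 1)"
  unfolding vec_eq_iff all_plus_one
  using assms by (simp add: total_coord_def triv_dilate axis_def algebra_simps)

text \<open>Openness is a statement about chart images. The coordinates of the scaled point stay in
  the image of \<open>W\<close> for small \<open>t\<close>, and injectivity of the chart brings this
  back to the point itself.\<close>

lemma eventually_dilate_in:
  assumes W: "open_in P W" "e \<in> W"
  shows "\<forall>\<^sub>F t in nhds 0. dilate (1 + t * a) e \<in> W"
proof -
  have "e \<in> points P" using W by (auto simp: open_in_def)
  then obtain U \<phi> V \<psi> where c: "(U, \<phi>) \<in> B" "(V, \<psi>) \<in> trivs \<Theta>" "e \<in> total_dom U V"
    unfolding points_def P_eq by auto
  then have e: "e \<in> tot \<Theta>" "prj \<Theta> e \<in> U" "prj \<Theta> e \<in> V"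
    using zero_section_compl_subset by (auto simp: total_dom_def)
  have "open (total_coord \<phi> \<psi> ` (total_dom U V \<inter> W))"
    using W(1) P_chart[OF c(1,2)] by (auto simp: open_in_def)
  moreover have "total_coord \<phi> \<psi> e \<in> total_coord \<phi> \<psi> ` (total_dom U V \<inter> W)"
    using c(3) W(2) by blast
  ultimately have "\<forall>\<^sub>F t in nhds 0. total_coord \<phi> \<psi> e + t *s axis (Inr 1) (a * \<psi> e $ 1)
      \<in> total_coord \<phi> \<psi> ` (total_dom U V \<inter> W)"
    by (rule eventually_line)
  then show ?thesis
  proof eventually_elim
    case (elim t)
    then obtain e' where e': "e' \<in> total_dom U V" "e' \<in> W"
      "total_coord \<phi> \<psi> (dilate (1 + t * a) e) = total_coord \<phi> \<psi> e'"
      unfolding total_coord_dilate[OF c(2) e(1,3), symmetric] by blast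
    then have "dilate (1 + t * a) e = e'"
      using e zero_section_compl_subset
      by (intro total_coord_inject[OF c(1,2)]) (auto simp: total_dom_def)
    then show ?case using e'(2) by simp
  qed
qed

section \<open>The quotient atlas and the Euler field on it\<close>

definition X :: "('e set, 'n + 1) atlas" where
  "X = quotient_atlas P q"

lemma X_cases:
  assumes "(S, \<theta>) \<in> X"
  obtains U \<phi> V \<psi> W where "(U, \<phi>) \<in> B" "(V, \<psi>) \<in> trivs \<Theta>" "W \<subseteq> total_dom U V"
    "open_in P W" "inj_on q W" "S = q ` W" "\<theta> = total_coord \<phi> \<psi> \<circ> inv_into W q"
    "\<And>e. e \<in> W \<Longrightarrow> \<theta> (q e) = total_coord \<phi> \<psi> e"
proof -
  obtain U \<phi> V \<psi> W where "(U, \<phi>) \<in> B" "(V, \<psi>) \<in> trivs \<Theta>" "W \<subseteq> total_dom U V"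
    "open_in P W" "inj_on q W" "S = q ` W" "\<theta> = total_coord \<phi> \<psi> \<circ> inv_into W q"
    using assms unfolding X_def quotient_atlas_def P_eq by auto
  moreover from this have "\<theta> (q e) = total_coord \<phi> \<psi> e" if "e \<in> W" for e
    using that by simp
  ultimately show ?thesis using that by blast
qed

lemma total_dom_subset_tot: "W \<subseteq> total_dom U V \<Longrightarrow> e \<in> W \<Longrightarrow> e \<in> tot \<Theta> \<and> prj \<Theta> e \<in> U \<and> prj \<Theta> e \<in> V"
  using zero_section_compl_subset by (auto simp: total_dom_def)

lemma proper_atlas_X: "proper_atlas X"
  unfolding proper_atlas_def
proof (intro ballI, clarify)
  fix S \<theta> assume "(S, \<theta>) \<in> X"
  then show "inj_on \<theta> S \<and> open (\<theta> ` S)"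
  proof (rule X_cases)
    fix U \<phi> V \<psi> W
    assume c: "(U, \<phi>) \<in> B" "(V, \<psi>) \<in> trivs \<Theta>" and W: "W \<subseteq> total_dom U V" "open_in P W"
      and S: "S = q ` W" and \<theta>: "\<And>e. e \<in> W \<Longrightarrow> \<theta> (q e) = total_coord \<phi> \<psi> e"
    have "inj_on \<theta> S"
    proof (rule inj_onI)
      fix p p' assume "p \<in> S" "p' \<in> S" and eq: "\<theta> p = \<theta> p'"
      then obtain e e' where e: "e \<in> W" "e' \<in> W" "p = q e" "p' = q e'" unfolding S by blast
      then have "e = e'"
        using eq \<theta> total_dom_subset_tot[OF W(1)] by (intro total_coord_inject[OF c]) auto
      then show "p = p'" using e by simp
    qed
    moreover have "\<theta> ` S = total_coord \<phi> \<psi> ` (total_dom U V \<inter> W)"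
      using \<theta> W(1) unfolding S image_image by (intro image_cong) auto
    moreover have "open (total_coord \<phi> \<psi> ` (total_dom U V \<inter> W))"
      using W(2) P_chart[OF c] by (auto simp: open_in_def)
    ultimately show ?thesis by simp
  qed
qed

text \<open>The generator of the fibrewise \<open>\<complex>\<^sup>*\<close>-action; it is \<open>\<zeta> \<partial>\<^sub>\<zeta>\<close> in every fibre coordinate \<open>\<zeta>\<close>.\<close>

definition euler_field :: "('e set, 'n + 1) chart \<Rightarrow> complex^('n + 1) \<Rightarrow> complex^('n + 1)" where
  "euler_field c z = axis (Inr 1) (z $ Inr 1)"

text \<open>The transition maps intertwine the fibrewise scaling, so along the fibre they are linear in the
  coordinate, whatever power of \<open>\<tau>\<close> relates the two lifts of a point.\<close>

lemma euler_field_transition: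
  assumes "(S, \<theta>) \<in> X" "(S', \<theta>') \<in> X" "p \<in> S" "p \<in> S'"
  shows "euler_field (S', \<theta>') (\<theta>' p) = jacobian (\<theta>' \<circ> inv_into S \<theta>) (\<theta> p) *v euler_field (S, \<theta>) (\<theta> p)"
proof -
  obtain U \<phi> V \<psi> W where c: "(U, \<phi>) \<in> B" "(V, \<psi>) \<in> trivs \<Theta>" and W: "W \<subseteq> total_dom U V" "open_in P W"
    and S: "S = q ` W" and \<theta>: "\<And>e. e \<in> W \<Longrightarrow> \<theta> (q e) = total_coord \<phi> \<psi> e"
    using X_cases[OF assms(1)] by metis
  obtain U' \<phi>' V' \<psi>' W' where c': "(U', \<phi>') \<in> B" "(V', \<psi>') \<in> trivs \<Theta>"
    and W': "W' \<subseteq> total_dom U' V'" "open_in P W'"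
    and S': "S' = q ` W'" and \<theta>': "\<And>e. e \<in> W' \<Longrightarrow> \<theta>' (q e) = total_coord \<phi>' \<psi>' e"
    using X_cases[OF assms(2)] by metis
  obtain e e' where e: "e \<in> W" "p = q e" and e': "e' \<in> W'" "p = q e'"
    using assms(3,4) unfolding S S' by blast
  note et = total_dom_subset_tot[OF W(1) e(1)] total_dom_subset_tot[OF W'(1) e'(1)]
  have inj: "inj_on \<theta> S" using proper_atlas_X assms(1) by (auto simp: proper_atlas_def)
  define \<zeta> where "\<zeta> = \<psi> e $ 1"
  define \<zeta>' where "\<zeta>' = \<psi>' e' $ 1"
  have \<zeta>: "\<zeta> \<noteq> 0"
    using zero_section_complD[of e, OF _ c(2)] W(1) e(1) et by (auto simp: \<zeta>_def total_dom_def)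
  have p: "\<theta> p = total_coord \<phi> \<psi> e" "\<theta>' p = total_coord \<phi>' \<psi>' e'"
    using \<theta>[OF e(1)] \<theta>'[OF e'(1)] e(2) e'(2) by simp_all
  \<comment> \<open>This value makes the first lift move with unit speed in its fibre coordinate, as
    the partial derivative demands. The same scaling moves the second lift with speed
    \<open>\<zeta>' / \<zeta>\<close>, which is then the only non-zero entry in the last column of
    the Jacobian.\<close>
  define a where "a = 1 / \<zeta>"
  have a: "a * \<zeta> = 1" and a': "a * \<zeta>' = \<zeta>' / \<zeta>"
    using \<zeta> by (simp_all add: a_def)
  have ev: "\<forall>\<^sub>F t in nhds 0. (\<theta>' \<circ> inv_into S \<theta>) (\<theta> p + t *s axis (Inr 1) 1)
      = \<theta>' p + t *s axis (Inr 1) (\<zeta>' / \<zeta>)"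
    using eventually_dilate_in[OF W(2) e(1), of a] eventually_dilate_in[OF W'(2) e'(1), of a]
  proof eventually_elim
    case (elim t)
    let ?c = "1 + t * a"
    have "\<theta> (q (dilate ?c e)) = \<theta> p + t *s axis (Inr 1) 1"
      using \<theta>[OF elim(1)] et \<zeta> by (simp add: p total_coord_dilate[OF c(2)] a flip: \<zeta>_def)
    then have "inv_into S \<theta> (\<theta> p + t *s axis (Inr 1) 1) = q (dilate ?c e)"
      using elim(1) S by (intro inv_into_f_eq[OF inj]) auto
    also have "\<dots> = q (dilate ?c e')"
      using et e(2) e'(2) by (intro orbit_dilate_cong) auto
    finally show ?case
      using \<theta>'[OF elim(2)] et by (simp add: p total_coord_dilate[OF c'(2)] a' flip: \<zeta>'_def)
  qed
  have "pderiv_at (Inr 1) (\<lambda>w. (\<theta>' \<circ> inv_into S \<theta>) w $ i) (\<theta> p) = axis (Inr 1) (\<zeta>' / \<zeta>) $ i" for i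
  proof (rule pderiv_at_eq)
    show "\<forall>\<^sub>F t in nhds 0. (\<theta>' \<circ> inv_into S \<theta>) (\<theta> p + t *s axis (Inr 1) 1) $ i
        = \<theta>' p $ i + t * axis (Inr 1) (\<zeta>' / \<zeta>) $ i"
      using ev by eventually_elim simp
    show "((\<lambda>t. \<theta>' p $ i + t * axis (Inr 1) (\<zeta>' / \<zeta>) $ i) has_field_derivative
        axis (Inr 1) (\<zeta>' / \<zeta>) $ i) (at 0)"
      by (auto intro!: derivative_eq_intros)
  qed
  then have "(jacobian (\<theta>' \<circ> inv_into S \<theta>) (\<theta> p) *v axis (Inr 1) \<zeta>) $ i = axis (Inr 1) \<zeta>' $ i" for i
    using \<zeta> by (simp add: matrix_vector_mult_def sum_UNIV_plus jacobian_def axis_def)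
  moreover have "\<theta> p $ Inr 1 = \<zeta>" "\<theta>' p $ Inr 1 = \<zeta>'"
    by (simp_all add: p total_coord_def \<zeta>_def \<zeta>'_def)
  ultimately show ?thesis
    by (simp add: euler_field_def vec_eq_iff)
qed

lemma holomorphic_euler_field: "holomorphic_vector_field X euler_field"
proof -
  have "\<forall>i. holo_on (\<lambda>z. euler_field c z $ i) S" for c S
    unfolding all_plus_one by (simp add: euler_field_def axis_def holo_on_const holo_on_nth)
  then show ?thesis
    using euler_field_transition unfolding holomorphic_vector_field_def by blast
qed

text \<open>The coefficient is the fibre coordinate, which does not vanish off the zero
  section.\<close>

lemma euler_field_nonzero:
  assumes "(S, \<theta>) \<in> X" "p \<in> S"
  shows "euler_field (S, \<theta>) (\<theta> p) \<noteq> 0"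
proof -
  obtain U \<phi> V \<psi> W where c: "(V, \<psi>) \<in> trivs \<Theta>" and W: "W \<subseteq> total_dom U V"
    and S: "S = q ` W" and \<theta>: "\<And>e. e \<in> W \<Longrightarrow> \<theta> (q e) = total_coord \<phi> \<psi> e"
    using X_cases[OF assms(1)] by metis
  obtain e where e: "e \<in> W" "p = q e" using assms(2) S by blast
  then have "\<psi> e $ 1 \<noteq> 0"
    using W by (intro zero_section_complD[OF _ c]) (auto simp: total_dom_def)
  then show ?thesis
    using \<theta>[OF e(1)] e(2) by (simp add: euler_field_def total_coord_def)
qed

section \<open>Open annuli that the orbit map embeds, and the existence of charts\<close>

definition annulus :: "'a set \<Rightarrow> 'a set \<Rightarrow> ('e \<Rightarrow> complex^1) \<Rightarrow> 'e set" where
  "annulus U V \<psi> = {e \<in> tot \<Theta>. prj \<Theta> e \<in> U \<inter> V \<and> 1 < cmod (\<psi> e $ 1) \<and> cmod (\<psi> e $ 1) < cmod \<tau>}"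

lemma annulus_subset:
  assumes "(V, \<psi>) \<in> trivs \<Theta>"
  shows "annulus U V \<psi> \<subseteq> total_dom U V"
proof
  fix e assume "e \<in> annulus U V \<psi>"
  then have e: "e \<in> tot \<Theta>" "prj \<Theta> e \<in> U \<inter> V" "1 < cmod (\<psi> e $ 1)"
    by (auto simp: annulus_def)
  then have "\<psi> e \<noteq> 0" by auto
  then show "e \<in> total_dom U V"
    using zero_section_complI[OF assms] e by (auto simp: total_dom_def)
qed

text \<open>A positive power of \<tau> multiplies moduli by at least |\<tau>|, and a modulus above 1
  then leaves the annulus. Exchanging the two points excludes negative powers.\<close>

lemma inj_on_orbit_annulus:
  assumes V: "(V, \<psi>) \<in> trivs \<Theta>"
  shows "inj_on q (annulus U V \<psi>)"
proof (rule inj_onI)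
  have m: "m \<le> 0" if "e \<in> annulus U V \<psi>" "dilate (\<tau> powi m) e \<in> annulus U V \<psi>" for m e
  proof (rule ccontr)
    assume "\<not> m \<le> 0"
    then have "cmod \<tau> \<le> cmod \<tau> powi m"
      using tau power_int_increasing[of 1 m "cmod \<tau>"] by simp
    also have "\<dots> < cmod \<tau> powi m * cmod (\<psi> e $ 1)"
      using that(1) zero_less_power_int[of "cmod \<tau>" m] tau_nonzero by (simp add: annulus_def)
    also have "\<dots> = cmod (\<psi> (dilate (\<tau> powi m) e) $ 1)"
      using that(1) by (simp add: annulus_def triv_dilate[OF V] norm_mult norm_power_int)
    finally show False using that(2) by (simp add: annulus_def)
  qed
  fix e e' assume e: "e \<in> annulus U V \<psi>" "e' \<in> annulus U V \<psi>" and eq: "q e = q e'"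
  have et: "e \<in> tot \<Theta>" "e' \<in> tot \<Theta>" using e by (auto simp: annulus_def)
  obtain m where m1: "e' = dilate (\<tau> powi m) e" using orbit_eqD[OF et eq] .
  then have "dilate (\<tau> powi (- m)) e' = e"
    using et tau_nonzero by (simp add: dilate_dilate dilate_1 flip: power_int_add)
  then have "m = 0" using m[of e m] m[of e' "- m"] e m1 by simp
  then show "e = e'" using m1 dilate_1[OF et(1)] by simp
qed

text \<open>Openness has to be tested in every chart of \<open>P\<close>, including those from other
  trivializations. There the bounds apply to a transition function times the fibre coordinate, which
  is holomorphic and hence continuous.\<close>

lemma open_in_annulus:
  assumes U: "(U, \<phi>) \<in> B" and V: "(V, \<psi>) \<in> trivs \<Theta>"
  shows "open_in P (annulus U V \<psi>)"
proof -
  have "open (total_coord \<phi>' \<psi>' ` (total_dom U' V' \<inter> annulus U V \<psi>))"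
    if U': "(U', \<phi>') \<in> B" and V': "(V', \<psi>') \<in> trivs \<Theta>" for U' \<phi>' V' \<psi>'
  proof -
    obtain g :: "'a \<Rightarrow> complex^1^1" where gh: "\<forall>i j. holo_fun B (\<lambda>x. g x $ i $ j) (V' \<inter> V)"
      and g: "\<forall>e \<in> tot \<Theta>. prj \<Theta> e \<in> V' \<inter> V \<longrightarrow> \<psi> e = g (prj \<Theta> e) *v \<psi>' e"
      using transition_matrix[OF V' V] .
    have g1: "\<psi> e $ 1 = g (prj \<Theta> e) $ 1 $ 1 * \<psi>' e $ 1"
      if "e \<in> tot \<Theta>" "prj \<Theta> e \<in> V'" "prj \<Theta> e \<in> V" for e
      using g that by (simp add: matrix_vector_mult_def)
    have inj: "inj_on \<phi>' U'" using proper U' by (auto simp: proper_atlas_def)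
    define N where "N = \<phi>' ` (U' \<inter> (V' \<inter> (U \<inter> V)))"
    have "N = \<phi>' ` (U' \<inter> V') \<inter> (\<phi>' ` (U' \<inter> U) \<inter> \<phi>' ` (U' \<inter> V))"
      using inj unfolding N_def inj_on_def by blast
    moreover have "open (\<phi>' ` (U' \<inter> V'))" "open (\<phi>' ` (U' \<inter> U))" "open (\<phi>' ` (U' \<inter> V))"
      using triv_open[OF V'] triv_open[OF V] open_dom[OF U] U' by (auto simp: open_in_def)
    ultimately have "open N" by (simp add: open_Int)
    \<comment> \<open>Over \<open>N\<close>, the base coordinates where both charts and both
      trivializations are available, \<open>G\<close> is the fibre coordinate of
      \<open>\<psi>\<close> expressed in the coordinates of \<open>\<phi>'\<close> and
      \<open>\<psi>'\<close>.\<close>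
    define G where "G w = g (inv_into U' \<phi>' (proj_left w)) $ 1 $ 1 * w $ Inr 1" for w :: "complex^('n + 1)"
    have "holo_on ((\<lambda>x. g x $ 1 $ 1) \<circ> inv_into U' \<phi>') N"
      using gh[rule_format, of 1 1] U' unfolding holo_fun_def by (rule_tac holo_on_subset[of _ "\<phi>' ` (U' \<inter> (V' \<inter> V))"]) (auto simp: N_def)
    then have "holo_on G (proj_left -` N)"
      unfolding G_def comp_def by (intro holo_on_mult holo_on_nth) (rule holo_on_proj_left, auto)
    then have "continuous_on (proj_left -` N) G"
      by (rule holo_on_imp_continuous_on)
    moreover have "open (proj_left -` N :: (complex^('n + 1)) set)"
      using \<open>open N\<close> bounded_linear_proj_left
      by (intro open_vimage linear_continuous_on)
    moreover have "open {x. 1 < cmod x \<and> cmod x < cmod \<tau>}"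
      by (intro open_Collect_conj open_Collect_less continuous_intros)
    ultimately have "open (proj_left -` N \<inter> G -` {x. 1 < cmod x \<and> cmod x < cmod \<tau>})"
      by (rule continuous_open_preimage)
    also have "proj_left -` N \<inter> G -` {x. 1 < cmod x \<and> cmod x < cmod \<tau>}
        = total_coord \<phi>' \<psi>' ` (total_dom U' V' \<inter> annulus U V \<psi>)"
    proof (intro equalityI subsetI)
      fix w assume w: "w \<in> proj_left -` N \<inter> G -` {x. 1 < cmod x \<and> cmod x < cmod \<tau>}"
      then obtain x where x: "x \<in> U'" "x \<in> V'" "x \<in> U" "x \<in> V" "proj_left w = \<phi>' x"
        unfolding N_def by auto
      obtain e where e: "e \<in> tot \<Theta>" "prj \<Theta> e = x" "\<psi>' e = vec (w $ Inr 1)"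
        using in_tot_ex[OF V' x(2)] .
      have "\<psi> e $ 1 = G w"
        using x e inj by (simp add: g1 G_def)
      then have "e \<in> annulus U V \<psi>" using w x e by (auto simp: annulus_def)
      moreover from this have "e \<in> total_dom U' V'"
        using annulus_subset[OF V, of U] x e by (auto simp: total_dom_def)
      moreover have "w = total_coord \<phi>' \<psi>' e"
        using e x(5) prod_coord_proj_left[of w] by (simp add: total_coord_def)
      ultimately show "w \<in> total_coord \<phi>' \<psi>' ` (total_dom U' V' \<inter> annulus U V \<psi>)" by blast
    next
      fix w assume "w \<in> total_coord \<phi>' \<psi>' ` (total_dom U' V' \<inter> annulus U V \<psi>)"
      then obtain e where e: "e \<in> total_dom U' V'" "e \<in> annulus U V \<psi>" "w = total_coord \<phi>' \<psi>' e"
        by blast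
      then have "G w = \<psi> e $ 1"
        using inj by (simp add: G_def total_coord_def g1 total_dom_def annulus_def)
      then show "w \<in> proj_left -` N \<inter> G -` {x. 1 < cmod x \<and> cmod x < cmod \<tau>}"
        using e by (auto simp: N_def total_coord_def total_dom_def annulus_def)
    qed
    finally show ?thesis .
  qed
  moreover have "annulus U V \<psi> \<subseteq> points P"
    using annulus_subset[OF V] chart_subset_points[OF P_chart[OF U V]] by blast
  ultimately show ?thesis
    unfolding open_in_def P_eq by blast
qed

text \<open>\<open>quotient_atlas\<close> only admits open sets on which \<open>q\<close> is
  injective, so the existence of a non-empty chart is a genuine claim. An annulus provides one, and
  any real \<open>r\<close> strictly between 1 and |\<tau>| provides a point in it.\<close>

lemma X_nonempty:
  obtains S \<theta> p where "(S, \<theta>) \<in> X" "p \<in> S"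
proof -
  obtain x where x: "x \<in> points B" using nonempty by blast
  obtain U \<phi> where U: "(U, \<phi>) \<in> B" "x \<in> U" using chart_at[OF x] .
  obtain V \<psi> where V: "(V, \<psi>) \<in> trivs \<Theta>" "x \<in> V" using triv_at[OF x] .
  obtain r where r: "1 < r" "r < cmod \<tau>" using dense[OF tau] by blast
  obtain e where e: "e \<in> tot \<Theta>" "prj \<Theta> e = x" "\<psi> e = vec (of_real r)" using in_tot_ex[OF V] .
  then have "e \<in> annulus U V \<psi>" using U V r by (simp add: annulus_def)
  moreover have "(q ` annulus U V \<psi>, total_coord \<phi> \<psi> \<circ> inv_into (annulus U V \<psi>) q) \<in> X"
    unfolding X_def quotient_atlas_def
    using P_chart[OF U(1) V(1)] annulus_subset[OF V(1)] open_in_annulus[OF U(1) V(1)]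
      inj_on_orbit_annulus[OF V(1)] by blast
  ultimately show ?thesis using that by blast
qed

end


section \<open>Hopf surfaces\<close>

text \<open>Each affine chart is a bijection onto the whole plane, and in either coordinate the
  overlap of two different charts is the plane without 0.\<close>

lemma proper_atlas_CP1: "proper_atlas CP1"
  and open_in_CP1_affine_dom: "open_in CP1 (affine_dom k)"
proof -
  have inj: "inj_on (\<lambda>L. vec (affine_coord k L) :: complex^1) (affine_dom k)" for k
    using affine_line_affine_coord by (intro inj_onI) (metis vec_component)
  have im: "(\<lambda>L. vec (affine_coord k L) :: complex^1) ` affine_dom k = UNIV" for k
  proof -
    have "z = vec (affine_coord k (affine_line k (z $ 1)))" for z :: "complex^1"
      by (simp add: vec_eq_iff)
    then show ?thesis using affine_line_in_affine_dom by blast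
  qed
  show "proper_atlas CP1"
    using inj im by (auto simp: proper_atlas_def CP1_def)
  have "open ((\<lambda>L. vec (affine_coord k' L) :: complex^1) ` (affine_dom k' \<inter> affine_dom k))" for k'
  proof (cases "k = k'")
    case False
    have "(\<lambda>L. vec (affine_coord k' L) :: complex^1) ` (affine_dom k' \<inter> affine_dom k) = {z. z $ 1 \<noteq> 0}"
    proof (intro equalityI subsetI)
      fix z :: "complex^1" assume "z \<in> {z. z $ 1 \<noteq> 0}"
      then have "affine_line k' (z $ 1) \<in> affine_dom k' \<inter> affine_dom k"
        using False affine_line_in_affine_dom affine_line_in_affine_dom' by simp
      moreover have "z = vec (affine_coord k' (affine_line k' (z $ 1)))"
        by (simp add: vec_eq_iff)
      ultimately show "z \<in> (\<lambda>L. vec (affine_coord k' L)) ` (affine_dom k' \<inter> affine_dom k)" by blast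
    next
      fix z :: "complex^1" assume "z \<in> (\<lambda>L. vec (affine_coord k' L)) ` (affine_dom k' \<inter> affine_dom k)"
      then obtain L where L: "L \<in> affine_dom k'" "L \<in> affine_dom k" "z = vec (affine_coord k' L)" by blast
      then have "affine_coord k' L \<noteq> 0"
        using affine_line_in_affine_dom'[OF False, of "affine_coord k' L"]
        by (simp add: affine_line_affine_coord)
      then show "z \<in> {z. z $ 1 \<noteq> 0}" using L(3) by simp
    qed
    moreover have "open {z :: complex^1. z $ 1 \<noteq> 0}"
      by (intro open_Collect_neq continuous_intros)
    ultimately show ?thesis by simp
  qed (simp add: im)
  then show "open_in CP1 (affine_dom k)"
    unfolding open_in_def points_CP1 using affine_dom_subset_clines by (auto simp: CP1_def)
qed

theorem mainTheorem3:
  fixes X :: "('e set, 1 + 1) atlas"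
  assumes "hopf_surface X"
  shows "\<exists>E :: ('e set \<times> (complex^2), 'e set, 2) vbundle.
           holomorphic_vector_bundle X E \<and> filtrable X E \<and>
           (\<exists>\<sigma>. poisson_structure (proj_bundle X E) \<sigma> \<and> nonzero_bivector (proj_bundle X E) \<sigma>)"
proof -
  obtain \<Theta> :: "('e, (complex^2) set, 1) vbundle" and \<tau> where
    \<Theta>: "holomorphic_vector_bundle CP1 \<Theta>" "1 < cmod \<tau>" and
    X: "X = quotient_atlas (open_submanifold (total_atlas CP1 \<Theta>) (zero_section_compl \<Theta>)) (orbit \<Theta> \<tau>)"
    using assms unfolding hopf_surface_def by blast
  interpret H: punctured_line_bundle_quotient CP1 \<Theta> \<tau>
  proof
    show "open_in CP1 U" if "(U, \<phi>) \<in> CP1" for U \<phi>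
      using that open_in_CP1_affine_dom by (auto simp: CP1_def)
    show "points CP1 \<noteq> {}"
      using affine_line_in_affine_dom affine_dom_subset_clines by (auto simp: points_CP1)
  qed (use \<Theta> proper_atlas_CP1 in auto)
  have X: "X = H.X" by (simp add: X H.X_def H.P_def)
  obtain S \<theta> p where "(S, \<theta>) \<in> H.X" "p \<in> S" using H.X_nonempty .
  then have "nonzero_bivector (proj_bundle X (trivial_bundle X)) (wedge_bivector X H.euler_field)"
    using nonzero_wedge_bivector[OF H.proper_atlas_X H.holomorphic_euler_field] H.euler_field_nonzero
    unfolding X by blast
  moreover have "poisson_structure (proj_bundle X (trivial_bundle X)) (wedge_bivector X H.euler_field)"
    unfolding X using poisson_wedge_bivector[OF H.proper_atlas_X H.holomorphic_euler_field] .
  ultimately show ?thesis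
    using holomorphic_trivial_bundle[OF H.proper_atlas_X] filtrable_trivial_bundle[OF H.proper_atlas_X]
    unfolding X by blast
qed

end
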